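(* Let $M>0$, $p\ge1$ and $a>1$. Assume that $Y_1,\dots,Y_n$ are observed in the multivariate convolution model $Y_i=X_i+\varepsilon_i$ in $\mathbb{R}^d$, and that $A$ is an invertible $d\times d$ matrix such that the coordinates of $A\varepsilon_1$ are independent. Assume that there exists $j_0\in\{1,\dots,d\}$ such that the coordinate $(A\varepsilon_1)_{j_0}$ has a density $g$ with respect to the Lebesgue measure on $\mathbb{R}$ satisfying, for all $w\in\mathbb{R}$, $$|g^*(w)|\,(1+|w|)^{-\tilde\beta}\exp\big(|w|^\beta/\gamma_1\big)\le c_1$$ for some $\beta>0$, some $\tilde\beta\in\mathbb{R}$ and some constants $\gamma_1>0$, $c_1>0$. Also assume that there exist constants $\kappa_1\in(0,1)$ and $\kappa_2>1$ such that $$P\big(|(A\varepsilon_1)_{j_0}-t|\le|t|^{\kappa_1}\big)=O(|t|^{-\kappa_2})\quad\text{as }|t|\to\infty$$ and $$\max\Big(p+1+\frac a2\,,\ \frac{\kappa_2}{2\kappa_1}+\frac12\Big)<\kappa_2.$$ Then there exists a constant $C>0$ such that for every estimator $\tilde\mu_n$ of the measure $\mu$, $$\liminf_{n\to\infty}\ (\log n)^{p/\beta}\sup_{\mu\in\mathcal{D}_A(M,p,a)}\mathbb{E}_{(\mu\star\mu_\varepsilon)^{\otimes n}}W_p^p(\tilde\mu_n,\mu)\ \ge\ C.$$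
   Context: Convolution model: $Y_i=X_i+\varepsilon_i$, $i=1,\dots,n$, in $\mathbb{R}^d$, where the $X_i$ are i.i.d. with unknown distribution $\mu$, the $\varepsilon_i$ are i.i.d. with known distribution $\mu_\varepsilon$, and $(X_i)$ and $(\varepsilon_i)$ are independent, so that the $Y_i$ are i.i.d. with distribution $\mu\star\mu_\varepsilon$ (convolution). $\mathbb{E}_{(\mu\star\mu_\varepsilon)^{\otimes n}}$ is the expectation when $(Y_1,\dots,Y_n)$ has law $(\mu\star\mu_\varepsilon)^{\otimes n}$. An estimator of $\mu$ is, for each $n$, a measurable function of $(Y_1,\dots,Y_n)$ (which may depend on the known $\mu_\varepsilon$ but not on $\mu$) with values in the set of probability measures on $\mathbb{R}^d$. For $p\ge1$, $W_p(\mu,\mu')=\inf_{\pi\in\Pi(\mu,\mu')}\left(\int_{\mathbb{R}^d\times\mathbb{R}^d}\|x-y\|^p\,\pi(dx,dy)\right)^{1/p}$, where $\Pi(\mu,\mu')$ is the set of probability measures on $\mathbb{R}^d\times\mathbb{R}^d$ with marginals $\mu$ and $\mu'$ and $\|\cdot\|$ is the Euclidean norm. Fourier transform: $g^*(w)=\int_{\mathbb{R}}e^{itw}g(t)\,dt$. For a $d\times d$ matrix $A$ and constants $M>0$, $p\ge1$, $a>1$, $\mathcal{D}_A(M,p,a)$ is the set of probability measures $\mu$ on $\mathbb{R}^d$ such that, with $X_1\sim\mu$, $$\sup_{1\le j\le d}\mathbb{E}_\mu\Big(\big(1+|(AX_1)_j|^{2p+a}\big)\prod_{1\le\ell\le d,\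 \ell\ne j}\big(1+|(AX_1)_\ell|^{a}\big)\Big)\le M.$$
   Formalization: The assumption M > 0 is replaced by M > 1: for M < 1 the class D_A(M,p,a) is empty, and for M = 1 it is {δ_0}, so the constant estimator δ_0 has zero risk and the claimed bound fails. *)

theory Defs
  imports "HOL-Probability.Probability" "HOL-Library.Landau_Symbols"
begin

(* Power with exponent r > 0 on [0, \<infinity>]. *)
definition ennpowr :: "ennreal \<Rightarrow> real \<Rightarrow> ennreal" where
  "ennpowr x r = (if x = \<top> then \<top> else ennreal (enn2real x powr r))"

definition couplings ::
  "'a::euclidean_space measure \<Rightarrow> 'a measure \<Rightarrow> ('a \<times> 'a) measure set" where
  "couplings \<mu> \<nu> = {\<pi> \<in> space (prob_algebra (borel \<Otimes>\<^sub>M borel)).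
     distr \<pi> borel fst = \<mu> \<and> distr \<pi> borel snd = \<nu>}"

(* Extended-valued: no moment condition is imposed on the two measures. *)
definition wasserstein ::
  "real \<Rightarrow> 'a::euclidean_space measure \<Rightarrow> 'a measure \<Rightarrow> ennreal" where
  "wasserstein p \<mu> \<nu> =
     (INF \<pi>\<in>couplings \<mu> \<nu>.
        ennpowr (\<integral>\<^sup>+ (x, y). ennreal (norm (x - y) powr p) \<partial>\<pi>) (1 / p))"

definition fourier :: "(real \<Rightarrow> real) \<Rightarrow> real \<Rightarrow> complex" where
  "fourier g w = (\<integral>t. exp (\<i> * of_real (t * w)) * of_real (g t) \<partial>lborel)"

(* The integrand is at least 1 everywhere, so the class is empty for M < 1, and
   for M = 1 and invertible A it contains only the point mass at 0. *)
definition moment_class ::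
  "real^'d^'d \<Rightarrow> real \<Rightarrow> real \<Rightarrow> real \<Rightarrow> (real^'d) measure set" where
  "moment_class A M p a = {\<mu> \<in> space (prob_algebra borel).
     (SUP j. \<integral>\<^sup>+ x. ennreal ((1 + \<bar>(A *v x) $ j\<bar> powr (2 * p + a)) *
        (\<Prod>l\<in>UNIV - {j}. 1 + \<bar>(A *v x) $ l\<bar> powr a)) \<partial>\<mu>) \<le> ennreal M}"

(* An estimator is a sequence, indexed by the sample size n, of functions of the
   observations y 0, ..., y (n - 1).  The sigma-algebra of prob_algebra borel is
   generated by the evaluations at Borel sets; on R^d it is the Borel
   sigma-algebra of weak convergence. *)
definition estimator :: "(nat \<Rightarrow> (nat \<Rightarrow> real^'d) \<Rightarrow> (real^'d) measure) \<Rightarrow> bool" where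
  "estimator \<mu>_est \<longleftrightarrow>
     (\<forall>n. \<mu>_est n \<in> measurable (PiM {..<n} (\<lambda>_. borel)) (prob_algebra borel))"

definition wasserstein_risk ::
  "real \<Rightarrow> (real^'d) measure \<Rightarrow> nat \<Rightarrow> ((nat \<Rightarrow> real^'d) \<Rightarrow> (real^'d) measure) \<Rightarrow>
   (real^'d) measure \<Rightarrow> ennreal" where
  "wasserstein_risk p \<mu>_eps n est \<mu> =
     (\<integral>\<^sup>+ y. ennpowr (wasserstein p (est y) \<mu>) p \<partial>(PiM {..<n} (\<lambda>_. \<mu> \<star> \<mu>_eps)))"

end

theory Submission
  imports Defs "HOL-Real_Asymp.Real_Asymp"
begin

text \<open>
The bound comes from two hypotheses that differ by an oscillation of frequency b, of order
(log n)^(1/\<beta>), in the single direction that only the coordinate j0 of A x sees.  Let f be a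
fixed even probability density on the line and let Z have density f(z) (1 + \<sigma> sin(b z)) with
\<sigma> = 1 or \<sigma> = -1; the hypotheses are the two laws of Z A^(-1) e_j0.

The hypotheses are far apart.  The function sin(b (A x)_j0) / (b K) is bounded, and it is
1-Lipschitz when K bounds the operator norm of A.  Its integrals under the two laws differ by
2/(b K) times the integral of f(z) sin(b z)^2, that is, by an amount of order 1/b
(integral_sin_square_lower_bound).  Every coupling of two measures moves mass by at least the
difference of the integrals of a 1-Lipschitz function (wasserstein_ge_lipschitz), so no estimator
can be closer than a multiple of b^(-p) to both hypotheses in W_p^p.  The same test function settles
measurability: the Wasserstein loss need not be a measurable function of the observations, but the
integral of the test function against the estimator is.

The observations hardly distinguish the hypotheses.  Let \<epsilon>' = (A \<epsilon>_1)_j0.  The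
coordinates of A \<epsilon>_1 are independent, and the hypotheses act on coordinate j0 only.
Therefore the two laws of one observation differ in total variation by no more than twice the L1 norm
of h, the convolution of f(z) sin(b z) with the density g of \<epsilon>' (observation_test_diff_le).
Choose f with a compactly supported Fourier transform: a rescaled even power of sin(x)/x.  The
oscillation shifts this support to frequencies near b, where the transform of g is at most
exp(-|b|^\<beta>/(2^\<beta> 2 \<gamma>1)), so that h is uniformly as small.  With a large multiple of
(log n)^(1/\<beta>) for b this is at most a constant times n^(-4).

To pass from a uniform bound to the L1 norm, split the line at |y| = R.  The inner part contributes
2 R times the supremum.  The outer part is at most a moment of order 1/2 divided by sqrt R, and that
moment is finite because the small-ball condition on \<epsilon>' forces integrable tails
(nn_integral_weight_finite).  Taking R of order n^2 makes the L1 norm at most 1/(4n).  Total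
variation adds up over independent observations (PiM_test_diff_le), so that with n observations it
is at most 1/2, and the two-point argument (two_point_minimax) gives a risk of order b^(-p), that
is, of order (log n)^(-p/\<beta>).  Since b grows only logarithmically, all the polynomial losses in
n on the way can be absorbed in the constant in front of (log n)^(1/\<beta>).
\<close>

section \<open>Test functions, Wasserstein distance and two hypotheses\<close>

text \<open>
Jensen's inequality for the power p, in a form that allows infinite integrals: integrate the tangent
of u^p at c, which lies below u^p.
\<close>

lemma powr_mean_le:
  assumes "prob_space M" and p: "p \<ge> 1" and c: "c \<ge> 0"
    and u0: "\<And>x. u x \<ge> 0" and [measurable]: "u \<in> borel_measurable M"
    and cu: "ennreal c \<le> (\<integral>\<^sup>+x. ennreal (u x) \<partial>M)"
  shows "ennreal (c powr p) \<le> (\<integral>\<^sup>+x. ennreal (u x powr p) \<partial>M)"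
proof (cases "c = 0")
  case True
  then show ?thesis by simp
next
  case False
  with c have c: "c > 0" by simp
  interpret prob_space M by fact
  have tangent: "p * c powr (p - 1) * u x + c powr p \<le> u x powr p + p * c powr p" for x
  proof (cases "u x = 0")
    case True
    with p show ?thesis by simp (smt (verit) mult_le_cancel_right1 powr_ge_zero)
  next
    case False
    with u0[of x] have u: "u x > 0" by simp
    have "(p * c powr (p - 1)) * (u x - c) \<le> u x powr p - c powr p"
      by (rule convex_on_imp_above_tangent[where A = "{0<..}"])
        (use u c p in \<open>auto intro!: powr_convex derivative_eq_intros simp: interior_open\<close>)
    moreover have "(p * c powr (p - 1)) * c = p * c powr p"
      using c by (simp add: powr_diff)
    ultimately show ?thesis by (simp add: right_diff_distrib)
  qed
  have "ennreal (p * c powr (p - 1)) * ennreal c + ennreal (c powr p)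
      \<le> ennreal (p * c powr (p - 1)) * (\<integral>\<^sup>+x. ennreal (u x) \<partial>M) + ennreal (c powr p)"
    by (intro add_mono mult_left_mono cu) auto
  also have "\<dots> = (\<integral>\<^sup>+x. ennreal (p * c powr (p - 1) * u x + c powr p) \<partial>M)"
    using p u0 by (simp add: ennreal_plus ennreal_mult nn_integral_add nn_integral_cmult emeasure_space_1 del: ennreal_plus[symmetric])
  also have "\<dots> \<le> (\<integral>\<^sup>+x. ennreal (u x powr p + p * c powr p) \<partial>M)"
    by (intro nn_integral_mono ennreal_leI tangent)
  also have "\<dots> = (\<integral>\<^sup>+x. ennreal (u x powr p) \<partial>M) + ennreal (p * c powr p)"
    using p by (simp add: nn_integral_add emeasure_space_1)
  finally have "ennreal (p * c powr p) + ennreal (c powr p)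
      \<le> (\<integral>\<^sup>+x. ennreal (u x powr p) \<partial>M) + ennreal (p * c powr p)"
    using c p by (simp add: ennreal_mult[symmetric] powr_diff)
  then show ?thesis
    by (simp add: add.commute[of _ "ennreal (p * c powr p)"] ennreal_add_left_cancel_le)
qed

text \<open>
The easy half of Kantorovich duality: under a coupling, the difference of the two integrals is the
mean of \<phi>(x) - \<phi>(y), hence at most the mean distance, hence at most the p-norm of the
distance.
\<close>

lemma wasserstein_ge_lipschitz:
  fixes \<mu> \<nu> :: "'a::euclidean_space measure" and \<phi> :: "'a \<Rightarrow> real"
  assumes p: "p \<ge> 1"
    and [measurable]: "\<phi> \<in> borel_measurable borel" and bd: "\<And>x. \<bar>\<phi> x\<bar> \<le> B"
    and lip: "\<And>x y. \<bar>\<phi> x - \<phi> y\<bar> \<le> norm (x - y)"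
  shows "ennreal (\<bar>(\<integral>x. \<phi> x \<partial>\<mu>) - (\<integral>x. \<phi> x \<partial>\<nu>)\<bar> powr p) \<le> ennpowr (wasserstein p \<mu> \<nu>) p"
proof -
  define L where "L = \<bar>(\<integral>x. \<phi> x \<partial>\<mu>) - (\<integral>x. \<phi> x \<partial>\<nu>)\<bar>"
  have "ennreal L \<le> ennpowr (\<integral>\<^sup>+ (x, y). ennreal (norm (x - y) powr p) \<partial>\<pi>) (1 / p)"
    if "\<pi> \<in> couplings \<mu> \<nu>" for \<pi>
  proof -
    from that have \<pi>: "prob_space \<pi>" and sets[measurable_cong]: "sets \<pi> = sets (borel \<Otimes>\<^sub>M borel)"
      and m1: "distr \<pi> borel fst = \<mu>" and m2: "distr \<pi> borel snd = \<nu>"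
      by (auto simp: couplings_def space_prob_algebra)
    interpret prob_space \<pi> by fact
    have int: "integrable \<pi> (\<lambda>z. \<phi> (fst z))" "integrable \<pi> (\<lambda>z. \<phi> (snd z))"
      by (intro integrable_const_bound[where B = B]; simp add: bd)+
    have "L = \<bar>\<integral>z. \<phi> (fst z) - \<phi> (snd z) \<partial>\<pi>\<bar>"
      unfolding L_def m1[symmetric] m2[symmetric]
      using int by (simp add: integral_distr)
    also have "ennreal \<dots> \<le> (\<integral>\<^sup>+z. ennreal \<bar>\<phi> (fst z) - \<phi> (snd z)\<bar> \<partial>\<pi>)"
      using integral_norm_bound_ennreal[of \<pi> "\<lambda>z. \<phi> (fst z) - \<phi> (snd z)"] int by simp
    also have "\<dots> \<le> (\<integral>\<^sup>+z. ennreal (norm (fst z - snd z)) \<partial>\<pi>)"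
      by (intro nn_integral_mono ennreal_leI lip)
    finally have "ennreal (L powr p) \<le> (\<integral>\<^sup>+z. ennreal (norm (fst z - snd z) powr p) \<partial>\<pi>)"
      by (intro powr_mean_le \<pi> p) (auto simp: L_def)
    also have "\<dots> = (\<integral>\<^sup>+ (x, y). ennreal (norm (x - y) powr p) \<partial>\<pi>)" (is "_ = ?I")
      by (intro nn_integral_cong) (simp add: case_prod_beta)
    finally have le: "ennreal (L powr p) \<le> ?I" .
    show ?thesis
    proof (cases "?I = \<top>")
      case True
      then show ?thesis by (simp add: ennpowr_def)
    next
      case False
      with le have "L powr p \<le> enn2real ?I"
        by (metis enn2real_ennreal enn2real_mono powr_ge_zero top.not_eq_extremum)
      then have "(L powr p) powr (1 / p) \<le> enn2real ?I powr (1 / p)"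
        using p by (intro powr_mono2) auto
      moreover have "(L powr p) powr (1 / p) = L"
        using p by (simp add: powr_powr L_def)
      ultimately show ?thesis using False by (simp add: ennpowr_def ennreal_leI)
    qed
  qed
  then have le: "ennreal L \<le> wasserstein p \<mu> \<nu>"
    unfolding wasserstein_def by (rule INF_greatest)
  have "ennreal (L powr p) \<le> ennpowr (wasserstein p \<mu> \<nu>) p"
  proof (cases "wasserstein p \<mu> \<nu> = \<top>")
    case False
    with le have "L \<le> enn2real (wasserstein p \<mu> \<nu>)"
      by (metis L_def abs_ge_zero enn2real_ennreal enn2real_mono top.not_eq_extremum)
    with False p show ?thesis
      by (simp add: ennpowr_def ennreal_leI powr_mono2 L_def)
  qed (simp add: ennpowr_def)
  then show ?thesis by (simp add: L_def)
qed

text \<open>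
Replacing the factors P by Q one at a time costs \<tau> at each step.  Total variation is
expressed through test functions with values in [0,1] instead of events, because integrating out the
last factor maps this class of functions to itself.
\<close>

lemma PiM_test_diff_le:
  fixes P Q :: "'a measure" and \<tau> :: real
  assumes "prob_space P" "prob_space Q" and sets[measurable_cong]: "sets Q = sets P"
    and one: "\<And>f. f \<in> borel_measurable P \<Longrightarrow> (\<And>x. 0 \<le> f x \<and> f x \<le> (1::real)) \<Longrightarrow>
      \<bar>(\<integral>x. f x \<partial>P) - (\<integral>x. f x \<partial>Q)\<bar> \<le> \<tau>"
    and "f \<in> borel_measurable (PiM {..<n::nat} (\<lambda>_. P))" "\<And>x. 0 \<le> f x \<and> f x \<le> (1::real)"
  shows "\<bar>(\<integral>x. f x \<partial>PiM {..<n} (\<lambda>_. P)) - (\<integral>x. f x \<partial>PiM {..<n} (\<lambda>_. Q))\<bar> \<le> real n * \<tau>"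
  using assms(5,6)
proof (induction n arbitrary: f)
  case 0
  then show ?case by (simp add: PiM_empty)
next
  case (Suc n)
  interpret P: prob_space P by fact
  interpret Q: prob_space Q by fact
  interpret PP: product_prob_space "\<lambda>_::nat. P" by standard
  interpret QQ: product_prob_space "\<lambda>_::nat. Q" by standard
  interpret Pn: prob_space "PiM {..<n} (\<lambda>_. P)" by (intro prob_space_PiM assms(1))
  interpret Qn: prob_space "PiM {..<n} (\<lambda>_. Q)" by (intro prob_space_PiM assms(2))
  interpret Pm: prob_space "PiM (insert n {..<n}) (\<lambda>_. P)" by (intro prob_space_PiM assms(1))
  interpret Qm: prob_space "PiM (insert n {..<n}) (\<lambda>_. Q)" by (intro prob_space_PiM assms(2))
  have [measurable_cong]: "sets (PiM I (\<lambda>_. Q)) = sets (PiM I (\<lambda>_. P))" for I :: "nat set"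
    by (intro sets_PiM_cong) (auto simp: sets)
  have ins: "{..<Suc n} = insert n {..<n}" by auto
  have f[measurable]: "f \<in> borel_measurable (PiM (insert n {..<n}) (\<lambda>_. P))"
    using Suc.prems(1) by (simp add: ins)
  have f01: "0 \<le> f x" "f x \<le> 1" for x
    using Suc.prems(2)[of x] by auto
  define FP where "FP x = (\<integral>y. f (x(n := y)) \<partial>P)" for x
  define FQ where "FQ x = (\<integral>y. f (x(n := y)) \<partial>Q)" for x
  have [measurable]: "FP \<in> borel_measurable (PiM {..<n} (\<lambda>_. P))"
    "FQ \<in> borel_measurable (PiM {..<n} (\<lambda>_. P))"
    unfolding FP_def FQ_def by measurable
  have sec: "(\<lambda>y. f (x(n := y))) \<in> borel_measurable P" if "x \<in> space (PiM {..<n} (\<lambda>_. P))" for x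
    using that by measurable
  have F01: "0 \<le> FP x \<and> FP x \<le> 1" "0 \<le> FQ x \<and> FQ x \<le> 1" for x
    unfolding FP_def FQ_def
    using f01 P.integral_le_const[of "\<lambda>y. f (x(n := y))" 1] Q.integral_le_const[of "\<lambda>y. f (x(n := y))" 1]
      not_integrable_integral_eq[of P "\<lambda>y. f (x(n := y))"]
      not_integrable_integral_eq[of Q "\<lambda>y. f (x(n := y))"]
    by (auto, (metis zero_le_one)+)
  have eqP: "(\<integral>x. f x \<partial>PiM {..<Suc n} (\<lambda>_. P)) = (\<integral>x. FP x \<partial>PiM {..<n} (\<lambda>_. P))"
    unfolding ins FP_def
    by (rule PP.product_integral_insert) (auto intro!: Pm.integrable_const_bound[where B = 1] simp: f01)
  have eqQ: "(\<integral>x. f x \<partial>PiM {..<Suc n} (\<lambda>_. Q)) = (\<integral>x. FQ x \<partial>PiM {..<n} (\<lambda>_. Q))"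
    unfolding ins FQ_def
    by (rule QQ.product_integral_insert) (auto intro!: Qm.integrable_const_bound[where B = 1] simp: f01)
  have iQ: "integrable (PiM {..<n} (\<lambda>_. Q)) FP" "integrable (PiM {..<n} (\<lambda>_. Q)) FQ"
    using F01 by (auto intro!: Qn.integrable_const_bound[where B = 1])
  have "\<bar>FP x - FQ x\<bar> \<le> \<tau>" if "x \<in> space (PiM {..<n} (\<lambda>_. P))" for x
    unfolding FP_def FQ_def by (intro one sec that) (auto simp: f01)
  moreover have "space (PiM {..<n} (\<lambda>_. Q)) = space (PiM {..<n} (\<lambda>_. P))"
    by (intro sets_eq_imp_space_eq sets_PiM_cong) (auto simp: sets)
  ultimately have "\<bar>\<integral>x. FP x - FQ x \<partial>PiM {..<n} (\<lambda>_. Q)\<bar> \<le> \<tau>"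
    using iQ by (intro Qn.integral_le_const Qn.integral_ge_const order_trans[OF integral_abs_bound]) auto
  moreover have "\<bar>(\<integral>x. FP x \<partial>PiM {..<n} (\<lambda>_. P)) - (\<integral>x. FP x \<partial>PiM {..<n} (\<lambda>_. Q))\<bar> \<le> real n * \<tau>"
    by (rule Suc.IH) (use F01 in auto)
  moreover have "(\<integral>x. FP x - FQ x \<partial>PiM {..<n} (\<lambda>_. Q)) =
      (\<integral>x. FP x \<partial>PiM {..<n} (\<lambda>_. Q)) - (\<integral>x. FQ x \<partial>PiM {..<n} (\<lambda>_. Q))"
    using iQ by simp
  ultimately show ?case
    unfolding eqP eqQ by (simp add: algebra_simps)
qed

text \<open>
Le Cam's two-point argument: T cannot be within D of both L0 and L1.  Whenever it is within D of
L0 it misses L1 by at least D, and this event has nearly the same probability under P and Q.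
\<close>

lemma two_point_risk:
  fixes T :: "'a \<Rightarrow> real"
  assumes "prob_space P" "prob_space Q" and sets[measurable_cong]: "sets Q = sets P"
    and [measurable]: "T \<in> borel_measurable P"
    and tv: "\<And>E. E \<in> sets P \<Longrightarrow> \<bar>measure P E - measure Q E\<bar> \<le> 1 / 2"
    and sep: "L0 - L1 \<ge> 2 * D" and D: "D \<ge> 0" and p: "p \<ge> 0"
  shows "ennreal (D powr p / 2) \<le>
    (\<integral>\<^sup>+y. ennreal (\<bar>T y - L0\<bar> powr p) \<partial>P) + (\<integral>\<^sup>+y. ennreal (\<bar>T y - L1\<bar> powr p) \<partial>Q)"
proof -
  interpret P: prob_space P by fact
  interpret Q: prob_space Q by fact
  have sp: "space Q = space P" by (rule sets_eq_imp_space_eq) fact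
  define E where "E = {y \<in> space P. D \<le> \<bar>T y - L0\<bar>}"
  define F where "F = {y \<in> space P. \<not> D \<le> \<bar>T y - L0\<bar>}"
  have [measurable]: "E \<in> sets P" "F \<in> sets P" by (auto simp: E_def F_def)
  have "ennreal (D powr p * measure P E) = (\<integral>\<^sup>+y. ennreal (D powr p) * indicator E y \<partial>P)"
    by (simp add: P.emeasure_eq_measure ennreal_mult nn_integral_cmult)
  also have "\<dots> \<le> (\<integral>\<^sup>+y. ennreal (\<bar>T y - L0\<bar> powr p) \<partial>P)"
    by (intro nn_integral_mono) (use D p in \<open>auto simp: E_def indicator_def intro!: ennreal_leI powr_mono2\<close>)
  finally have 1: "ennreal (D powr p * measure P E) \<le> (\<integral>\<^sup>+y. ennreal (\<bar>T y - L0\<bar> powr p) \<partial>P)" .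
  have "ennreal (D powr p * measure Q F) = (\<integral>\<^sup>+y. ennreal (D powr p) * indicator F y \<partial>Q)"
    by (simp add: Q.emeasure_eq_measure ennreal_mult nn_integral_cmult)
  also have "\<dots> \<le> (\<integral>\<^sup>+y. ennreal (\<bar>T y - L1\<bar> powr p) \<partial>Q)"
    by (intro nn_integral_mono) (use D p sep in \<open>auto simp: F_def indicator_def intro!: ennreal_leI powr_mono2\<close>)
  finally have 2: "ennreal (D powr p * measure Q F) \<le> (\<integral>\<^sup>+y. ennreal (\<bar>T y - L1\<bar> powr p) \<partial>Q)" .
  have "F = space P - E" by (auto simp: E_def F_def)
  then have "measure P F = 1 - measure P E" by (simp add: P.prob_compl)
  moreover have "\<bar>measure P F - measure Q F\<bar> \<le> 1 / 2" by (rule tv) simp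
  ultimately have "1 / 2 \<le> measure P E + measure Q F" by linarith
  then have "D powr p * (1 / 2) \<le> D powr p * (measure P E + measure Q F)"
    by (intro mult_left_mono) auto
  then have "ennreal (D powr p / 2) \<le> ennreal (D powr p * measure P E + D powr p * measure Q F)"
    by (intro ennreal_leI) (simp add: algebra_simps)
  also have "\<dots> = ennreal (D powr p * measure P E) + ennreal (D powr p * measure Q F)"
    by (simp add: ennreal_plus)
  also note add_mono[OF 1 2]
  finally show ?thesis .
qed

section \<open>A band-limited probability density\<close>

text \<open>
A constant of its own, since sinc abbreviates a case distinction at 0 that would otherwise be split
wherever the function occurs.
\<close>

definition card_sine :: "real \<Rightarrow> real" where
  "card_sine x = sinc x"

lemma card_sine_measurable[measurable]: "card_sine \<in> borel_measurable borel"
  unfolding card_sine_def[abs_def] by (rule borel_measurable_sinc)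

lemma abs_card_sine_le_1: "\<bar>card_sine x\<bar> \<le> 1"
  unfolding card_sine_def using abs_sin_x_le_abs_x[of x] by (auto simp: abs_divide divide_le_eq)

text \<open>
The cardinal sine is the characteristic function of the uniform distribution on [-1,1].
\<close>

lemma integral_exp_eq_card_sine:
  "(\<integral>w. (indicator {-1..1} w / 2) * exp (\<i> * of_real (\<theta> * w)) \<partial>lborel) = of_real (card_sine \<theta>)"
proof (cases "\<theta> = 0")
  case True
  have "(\<integral>w. complex_of_real (indicator {-1..1} (w::real) / 2) \<partial>lborel) = of_real (\<integral>w. indicator {-1..1} (w::real) / 2 \<partial>lborel)"
    by (rule Bochner_Integration.integral_complex_of_real)
  moreover have "(indicator {-1..1} w / 2 :: complex) = of_real (indicator {-1..1} w / 2)" for w :: real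
    by (simp add: indicator_def)
  ultimately show ?thesis
    using True by (simp add: card_sine_def)
next
  case False
  define F where "F w = exp (\<i> * of_real (\<theta> * w)) / (2 * \<i> * of_real \<theta>)" for w :: real
  have "(F has_vector_derivative exp (\<i> * of_real (\<theta> * w)) / 2) (at w within {-1..1})" for w
    unfolding F_def using False
    by (auto intro!: derivative_eq_intros has_vector_derivative_real_field simp: field_simps)
  then have "(\<integral>w. indicator {-1..1} w *\<^sub>R (exp (\<i> * of_real (\<theta> * w)) / 2) \<partial>lborel) = F 1 - F (-1)"
    by (intro integral_FTC_Icc) (auto intro!: continuous_intros)
  also have "\<dots> = of_real (card_sine \<theta>)"
    using False by (simp add: F_def card_sine_def sin_of_real[symmetric] sin_exp_eq field_simps)
  also have "(\<integral>w. indicator {-1..1} w *\<^sub>R (exp (\<i> * of_real (\<theta> * w)) / 2) \<partial>lborel)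
     = (\<integral>w. (indicator {-1..1} w / 2) * exp (\<i> * of_real (\<theta> * w)) \<partial>lborel)"
    by (intro Bochner_Integration.integral_cong) (auto simp: indicator_def)
  finally show ?thesis .
qed

text \<open>
Each factor card_sine (l x) is an average of exp(i l w x) over w in [-1,1].  Multiplying by it
therefore averages the integral over frequencies within l of s, and k factors reach no further than
k l.  This is the compact support of the Fourier transform of the power, obtained by Fubini and
without any inversion formula.
\<close>

lemma norm_integral_card_sine_power_le:
  fixes g :: "real \<Rightarrow> real"
  assumes g: "integrable lborel g"
    and dec: "\<And>w. \<bar>w\<bar> \<ge> s0 \<Longrightarrow> cmod (fourier g w) \<le> \<rho>"
    and s: "\<bar>s\<bar> \<ge> s0 + real k * l" and l: "l > 0"
  shows "cmod (\<integral>x. exp (\<i> * of_real (s * x)) * of_real (card_sine (l * x) ^ k * g (y - x)) \<partial>lborel) \<le> \<rho>"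
  using s
proof (induction k arbitrary: s)
  case 0
  have "(\<integral>x. exp (\<i> * of_real (s * x)) * of_real (g (y - x)) \<partial>lborel)
      = (\<integral>t. exp (\<i> * of_real (s * y)) * (exp (\<i> * of_real (t * (- s))) * of_real (g t)) \<partial>lborel)"
    by (subst lborel_integral_real_affine[where c = "-1" and t = y])
      (auto intro!: Bochner_Integration.integral_cong simp: exp_add[symmetric] algebra_simps)
  also have "\<dots> = exp (\<i> * of_real (s * y)) * fourier g (- s)"
    by (simp add: fourier_def)
  finally show ?case
    using dec[of "- s"] 0 by (simp add: norm_mult)
next
  case (Suc k)
  have gm[measurable]: "g \<in> borel_measurable borel"
    using borel_measurable_integrable[OF g] by simp
  have gy: "integrable lborel (\<lambda>x. g (y - x))"
    using lborel_integrable_real_affine[OF g, of "-1" y] by simp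
  \<comment> \<open>One factor is replaced by its integral over \<open>w\<close>; \<open>G w\<close> is what
    the induction hypothesis bounds, at frequency \<open>s + l w\<close>.\<close>
  define H where "H x w = (indicator {-1..1} w / 2) *
    (exp (\<i> * of_real ((s + l * w) * x)) * of_real (card_sine (l * x) ^ k * g (y - x)))" for x w :: real
  define G where "G w = (\<integral>x. exp (\<i> * of_real ((s + l * w) * x)) * of_real (card_sine (l * x) ^ k * g (y - x)) \<partial>lborel)" for w
  have [measurable]: "case_prod H \<in> borel_measurable (lborel \<Otimes>\<^sub>M lborel)"
    unfolding H_def by measurable
  have nH: "norm (H x w) = indicator {-1..1} w * (\<bar>card_sine (l * x)\<bar> ^ k * \<bar>g (y - x)\<bar> / 2)" for x w
    by (simp add: H_def norm_mult norm_divide norm_power indicator_def abs_mult)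
  have iind: "integrable lborel (indicator {-1..1} :: real \<Rightarrow> real)"
    by simp
  have intH: "integrable (lborel \<Otimes>\<^sub>M lborel) (case_prod H)"
  proof (rule lborel_pair.Fubini_integrable)
    have "integrable lborel (\<lambda>x. \<bar>card_sine (l * x)\<bar> ^ k * \<bar>g (y - x)\<bar>)"
      by (rule Bochner_Integration.integrable_bound[OF gy])
        (auto intro!: mult_left_le_one_le power_le_one abs_card_sine_le_1)
    then show "integrable lborel (\<lambda>x. \<integral>w. norm (case (x, w) of (x, w) \<Rightarrow> H x w) \<partial>lborel)"
      by (simp add: nH)
    show "AE x in lborel. integrable lborel (\<lambda>w. case (x, w) of (x, w) \<Rightarrow> H x w)"
    proof (rule AE_I2)
      fix x :: real
      have "integrable lborel (\<lambda>w. norm (H x w))"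
        unfolding nH by (intro integrable_mult_left iind)
      then show "integrable lborel (\<lambda>w. case (x, w) of (x, w) \<Rightarrow> H x w)"
        unfolding prod.case by (rule integrable_norm_cancel) (simp add: H_def)
    qed
  qed simp
  have "(\<integral>x. exp (\<i> * of_real (s * x)) * of_real (card_sine (l * x) ^ Suc k * g (y - x)) \<partial>lborel)
      = (\<integral>x. (\<integral>w. H x w \<partial>lborel) \<partial>lborel)"
  proof (rule Bochner_Integration.integral_cong[OF refl])
    fix x :: real
    have "(\<integral>w. H x w \<partial>lborel) = (\<integral>w. ((indicator {-1..1} w / 2) * exp (\<i> * of_real ((l * x) * w))) *
        (exp (\<i> * of_real (s * x)) * of_real (card_sine (l * x) ^ k * g (y - x))) \<partial>lborel)"
      by (intro Bochner_Integration.integral_cong refl)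
        (simp add: H_def exp_add[symmetric] algebra_simps)
    also have "\<dots> = of_real (card_sine (l * x)) * (exp (\<i> * of_real (s * x)) * of_real (card_sine (l * x) ^ k * g (y - x)))"
      by (subst integral_mult_left_zero, subst integral_exp_eq_card_sine) simp
    finally show "exp (\<i> * of_real (s * x)) * of_real (card_sine (l * x) ^ Suc k * g (y - x)) = (\<integral>w. H x w \<partial>lborel)"
      by (simp add: mult_ac)
  qed
  also have "\<dots> = (\<integral>w. (\<integral>x. H x w \<partial>lborel) \<partial>lborel)"
    by (rule lborel_pair.Fubini_integral[OF intH, symmetric])
  also have "\<dots> = (\<integral>w. (indicator {-1..1} w / 2) * G w \<partial>lborel)"
    by (simp add: H_def G_def)
  also have "cmod \<dots> \<le> (\<integral>w. indicator {-1..1} (w::real) * (\<rho> / 2) \<partial>lborel)"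
  proof (rule order_trans[OF Bochner_Integration.integral_norm_bound integral_mono[OF integrable_norm integrable_mult_left[OF iind]]])
    have "integrable lborel (\<lambda>w. \<integral>x. H x w \<partial>lborel)"
      by (rule lborel_pair.integrable_snd[OF intH])
    then show "integrable lborel (\<lambda>w. (indicator {-1..1} w / 2) * G w)"
      by (simp add: H_def G_def)
    fix w :: real
    show "norm (indicator {-1..1} w / 2 * G w) \<le> indicator {-1..1} w * (\<rho> / 2)"
    proof (cases "w \<in> {-1..1}")
      case True
      then have "\<bar>l * w\<bar> \<le> l"
        using l by (auto simp: abs_mult)
      then have "\<bar>s + l * w\<bar> \<ge> s0 + real k * l"
        using Suc.prems by (simp add: algebra_simps)
      then have "cmod (G w) \<le> \<rho>"
        unfolding G_def by (rule Suc.IH)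
      with True show ?thesis by (simp add: norm_mult)
    qed simp
  qed
  also have "\<dots> = \<rho>"
    by simp
  finally show ?case .
qed

lemma integrable_inverse_1_plus_square_lborel:
  "integrable lborel (\<lambda>x::real. inverse (1 + x\<^sup>2))"
  using integrable_inverse_1_plus_square by (simp add: set_integrable_def)

text \<open>
By continuity f is at least f(0)/2 on a fixed interval [0,\<delta>], on which the mean of sin(b x)^2
tends to 1/2 as b grows.
\<close>

lemma integral_sin_square_lower_bound:
  fixes f :: "real \<Rightarrow> real"
  assumes f: "integrable lborel f" and nn: "\<And>x. 0 \<le> f x" and cont: "isCont f 0" and pos: "f 0 > 0"
  obtains c b0 where "c > 0" "\<And>b. b \<ge> b0 \<Longrightarrow> c \<le> (\<integral>x. f x * (sin (b * x))\<^sup>2 \<partial>lborel)"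
proof -
  from cont pos obtain \<delta>' where \<delta>': "\<delta>' > 0" "\<And>x. \<bar>x\<bar> < \<delta>' \<Longrightarrow> \<bar>f x - f 0\<bar> < f 0 / 2"
    using half_gt_zero[OF pos] unfolding continuous_at_real_range real_norm_def dist_real_def by (metis diff_zero)
  define \<delta> where "\<delta> = \<delta>' / 2"
  have \<delta>: "\<delta> > 0" and low: "f 0 / 2 \<le> f x" if "x \<in> {0..\<delta>}" for x
    using \<delta>'(1) \<delta>'(2)[of x] that by (auto simp: \<delta>_def abs_if split: if_splits)
  have \<delta>: "\<delta> > 0" using \<delta>'(1) by (simp add: \<delta>_def)
  have [measurable]: "f \<in> borel_measurable borel"
    using borel_measurable_integrable[OF f] by simp
  have "f 0 * \<delta> / 8 \<le> (\<integral>x. f x * (sin (b * x))\<^sup>2 \<partial>lborel)" if "b \<ge> 1 / \<delta>" for b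
  proof -
    have b: "b > 0" using that \<delta> by (meson less_le_trans zero_less_divide_1_iff)
    define F where "F x = x / 2 - sin (2 * b * x) / (4 * b)" for x
    have "(F has_real_derivative (sin (b * x))\<^sup>2) (at x)" for x
      unfolding F_def using b cos_double_sin[of "b * x"]
      by (auto intro!: derivative_eq_intros simp: mult.assoc) (simp add: field_simps)
    then have I: "(\<integral>x. indicator {0..\<delta>} x *\<^sub>R (sin (b * x))\<^sup>2 \<partial>lborel) = F \<delta> - F 0"
      using \<delta> by (intro integral_FTC_Icc)
        (auto intro!: continuous_intros simp: has_real_derivative_iff_has_vector_derivative
          intro: has_vector_derivative_at_within)
    have "sin (2 * b * \<delta>) \<le> b * \<delta>"
    proof -
      have "1 \<le> b * \<delta>" using that \<delta> by (simp add: pos_divide_le_eq)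
      then show ?thesis using sin_le_one[of "2 * b * \<delta>"] by linarith
    qed
    then have "\<delta> / 4 \<le> F \<delta> - F 0"
      using b by (simp add: F_def field_simps)
    then have "f 0 * \<delta> / 8 \<le> f 0 / 2 * (F \<delta> - F 0)"
      using mult_left_mono[of "\<delta> / 4" "F \<delta> - F 0" "f 0 / 2"] pos by simp
    also have "\<dots> = (\<integral>x. f 0 / 2 * (indicator {0..\<delta>} x *\<^sub>R (sin (b * x))\<^sup>2) \<partial>lborel)"
      by (simp only: integral_mult_right_zero I)
    also have "\<dots> \<le> (\<integral>x. f x * (sin (b * x))\<^sup>2 \<partial>lborel)"
    proof (rule integral_mono)
      have "integrable lborel (\<lambda>x. indicator {0..\<delta>} x *\<^sub>R (sin (b * x))\<^sup>2)"
        by (intro borel_integrable_atLeastAtMost'[unfolded set_integrable_def]) (auto intro!: continuous_intros)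
      then show "integrable lborel (\<lambda>x. f 0 / 2 * (indicator {0..\<delta>} x *\<^sub>R (sin (b * x))\<^sup>2))"
        by (rule integrable_mult_right)
      show "integrable lborel (\<lambda>x. f x * (sin (b * x))\<^sup>2)"
        by (rule Bochner_Integration.integrable_bound[OF f])
          (auto simp: abs_mult nn abs_square_le_1 intro!: mult_right_le_one_le)
      show "f 0 / 2 * (indicator {0..\<delta>} x *\<^sub>R (sin (b * x))\<^sup>2) \<le> f x * (sin (b * x))\<^sup>2" for x
        using mult_right_mono[OF low[of x] zero_le_power2[of "sin (b * x)"]] nn[of x]
        by (cases "x \<in> {0..\<delta>}") auto
    qed
    finally show ?thesis .
  qed
  then show ?thesis
    using that[of "f 0 * \<delta> / 8" "1 / \<delta>"] pos \<delta> by simp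
qed

text \<open>
Smoothing f(x) exp(i s x) by g sees only frequencies of g within \<Lambda> of s.  For a density f with
Fourier transform supported in [-\<Lambda>,\<Lambda>] this holds with the L1 norm of that transform as C
(up to the normalisation); stated as an inequality it makes no reference to inversion.
\<close>

definition band_limited :: "(real \<Rightarrow> real) \<Rightarrow> real \<Rightarrow> real \<Rightarrow> bool" where
  "band_limited f \<Lambda> C \<longleftrightarrow> (\<forall>g s0 \<rho>. integrable lborel g \<longrightarrow>
     (\<forall>w. \<bar>w\<bar> \<ge> s0 \<longrightarrow> cmod (fourier g w) \<le> \<rho>) \<longrightarrow>
     (\<forall>s y. \<bar>s\<bar> \<ge> s0 + \<Lambda> \<longrightarrow>
        cmod (\<integral>x. exp (\<i> * of_real (s * x)) * of_real (f x * g (y - x)) \<partial>lborel) \<le> C * \<rho>))"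

lemma card_sine_neg[simp]: "card_sine (- x) = card_sine x"
  by (simp add: card_sine_def)

lemma isCont_card_sine: "isCont card_sine x"
  unfolding card_sine_def[abs_def] by (rule isCont_sinc)

text \<open>
The left-hand side is bounded near 0, and at infinity the decay |x|^(-2m) beats the weight |x|^q by
two powers.
\<close>

lemma card_sine_power_moment:
  assumes q: "q \<ge> 1" and m: "2 * real m \<ge> q + 2"
  shows "(1 + \<bar>x\<bar> + \<bar>x\<bar> powr q) * card_sine x ^ (2 * m) \<le> 6 * inverse (1 + x\<^sup>2)"
proof (cases "\<bar>x\<bar> \<le> 1")
  case True
  have "\<bar>x\<bar> powr q \<le> 1" using True q by (intro powr_le1) auto
  moreover have "card_sine x ^ (2 * m) \<le> 1"
    using abs_card_sine_le_1[of x] by (simp add: power_mult power_le_one abs_square_le_1)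
  ultimately have "(1 + \<bar>x\<bar> + \<bar>x\<bar> powr q) * card_sine x ^ (2 * m) \<le> 3 * 1"
    using True by (intro mult_mono) (auto simp: power_mult)
  moreover have "x\<^sup>2 \<le> 1" using True by (simp add: abs_square_le_1)
  then have "3 \<le> 6 * inverse (1 + x\<^sup>2)"
    by (simp add: field_simps add_pos_nonneg)
  ultimately show ?thesis by simp
next
  case False
  then have x: "\<bar>x\<bar> > 1" by simp
  have x1: "\<bar>x\<bar> \<le> \<bar>x\<bar> powr q" "1 \<le> \<bar>x\<bar> powr q"
    using powr_mono[of 1 q "\<bar>x\<bar>"] x q by (auto simp: ge_one_powr_ge_zero)
  have "\<bar>card_sine x\<bar> \<le> inverse \<bar>x\<bar>"
    using x by (auto simp: card_sine_def divide_inverse abs_mult intro!: mult_left_le_one_le)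
  then have "\<bar>card_sine x\<bar> ^ (2 * m) \<le> inverse \<bar>x\<bar> ^ (2 * m)"
    by (intro power_mono) auto
  also have "\<dots> = \<bar>x\<bar> powr (- (2 * real m))"
    using x by (simp add: powr_minus power_inverse powr_realpow[symmetric])
  also have "\<dots> \<le> \<bar>x\<bar> powr (- (q + 2))"
    using x m by (intro powr_mono) auto
  finally have "card_sine x ^ (2 * m) \<le> \<bar>x\<bar> powr (- (q + 2))"
    by (simp add: power_even_abs)
  moreover have "1 + \<bar>x\<bar> + \<bar>x\<bar> powr q \<le> 3 * \<bar>x\<bar> powr q"
    using x1 by simp
  ultimately have "(1 + \<bar>x\<bar> + \<bar>x\<bar> powr q) * card_sine x ^ (2 * m)
      \<le> (3 * \<bar>x\<bar> powr q) * \<bar>x\<bar> powr (- (q + 2))"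
    by (intro mult_mono) (auto simp: power_mult)
  also have "\<dots> = 3 * \<bar>x\<bar> powr (- 2)"
    by (simp add: powr_add[symmetric])
  also have "\<dots> = 3 / x\<^sup>2"
    using x by (simp add: powr_minus powr_numeral divide_inverse)
  also have "\<dots> \<le> 6 * inverse (1 + x\<^sup>2)"
  proof -
    have "x\<^sup>2 \<ge> 1" using x by (metis abs_1 abs_le_square_iff less_imp_le one_power2)
    then have "3 * (1 + x\<^sup>2) \<le> 6 * x\<^sup>2" "x\<^sup>2 > 0" "1 + x\<^sup>2 > 0" by auto
    then show ?thesis by (simp add: divide_simps)
  qed
  finally show ?thesis .
qed

text \<open>
The density is a normalised even power of the cardinal sine, compressed by a factor l.  The power is
taken high enough for a moment of order q, and compression makes the moments of orders 1 to q as
small as required; this is how the hypotheses fit into a moment class whose bound barely exceeds 1.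
\<close>

lemma ex_band_limited_density:
  assumes q: "q \<ge> 1" and \<epsilon>: "\<epsilon> > 0"
  obtains f \<Lambda> C where
    "f \<in> borel_measurable borel" "\<And>x. 0 \<le> f x" "\<And>x. f (- x) = f x" "isCont f 0" "f 0 > 0"
    "integrable lborel f" "(\<integral>x. f x \<partial>lborel) = 1"
    "integrable lborel (\<lambda>x. (\<bar>x\<bar> + \<bar>x\<bar> powr q) * f x)"
    "(\<integral>x. (\<bar>x\<bar> + \<bar>x\<bar> powr q) * f x \<partial>lborel) \<le> \<epsilon>"
    "band_limited f \<Lambda> C" "C \<ge> 0"
proof -
  define m where "m = nat \<lceil>q + 2\<rceil>"
  have m: "2 * real m \<ge> q + 2" using q unfolding m_def by linarith
  define S where "S x = card_sine x ^ (2 * m)" for x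
  have [measurable]: "S \<in> borel_measurable borel" unfolding S_def[abs_def] by measurable
  have S0: "0 \<le> S x" for x by (simp add: S_def power_mult)
  define W where "W x = \<bar>x\<bar> + \<bar>x\<bar> powr q" for x :: real
  have W0: "0 \<le> W x" for x by (simp add: W_def)
  have [measurable]: "W \<in> borel_measurable borel" unfolding W_def[abs_def] by measurable
  have bound: "(1 + W x) * S x \<le> 6 * inverse (1 + x\<^sup>2)" for x
    using card_sine_power_moment[OF q m, of x] by (simp add: W_def S_def add.assoc)
  have i6: "integrable lborel (\<lambda>x::real. 6 * inverse (1 + x\<^sup>2))"
    by (intro integrable_mult_right integrable_inverse_1_plus_square_lborel)
  have iS: "integrable lborel S"
  proof (rule Bochner_Integration.integrable_bound[OF i6])
    have "S x \<le> 6 * inverse (1 + x\<^sup>2)" for x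
      using bound[of x] mult_nonneg_nonneg[OF W0[of x] S0[of x]] by (simp add: distrib_right)
    then show "AE x in lborel. norm (S x) \<le> norm (6 * inverse (1 + x\<^sup>2))"
      using S0 by (intro AE_I2) (auto simp: abs_of_nonneg)
  qed simp
  have iWS: "integrable lborel (\<lambda>x. W x * S x)"
  proof (rule Bochner_Integration.integrable_bound[OF i6])
    have "W x * S x \<le> 6 * inverse (1 + x\<^sup>2)" for x
      using bound[of x] S0[of x] by (simp add: distrib_right)
    then show "AE x in lborel. norm (W x * S x) \<le> norm (6 * inverse (1 + x\<^sup>2))"
      using S0 W0 by (intro AE_I2) (auto simp: abs_of_nonneg)
  qed simp
  define I where "I = (\<integral>x. S x \<partial>lborel)"
  have Spos: "S 0 > 0" by (simp add: S_def card_sine_def)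
  have contS: "isCont S 0"
    unfolding S_def[abs_def] by (intro continuous_intros isCont_card_sine)
  have I: "I > 0"
  proof -
    obtain c b0 where c: "c > 0" "\<And>b. b \<ge> b0 \<Longrightarrow> c \<le> (\<integral>x. S x * (sin (b * x))\<^sup>2 \<partial>lborel)"
      using integral_sin_square_lower_bound[OF iS S0 contS Spos] by blast
    note c(1)
    also have "c \<le> (\<integral>x. S x * (sin (b0 * x))\<^sup>2 \<partial>lborel)" by (rule c) simp
    also have "\<dots> \<le> I"
      unfolding I_def by (intro integral_mono' iS)
        (auto simp: S0 abs_square_le_1 intro!: mult_right_le_one_le)
    finally show ?thesis .
  qed
  define J where "J = (\<integral>x. W x * S x \<partial>lborel) / I"
  have J0: "J \<ge> 0" using I S0 W0 by (auto simp: J_def intro!: divide_nonneg_pos integral_nonneg_AE)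
  \<comment> \<open>Compression by \<open>l\<close> divides the moment \<open>J\<close> by at least \<open>l\<close>.\<close>
  define l where "l = max 1 (J / \<epsilon>)"
  have l: "l \<ge> 1" "l > 0" "J / \<epsilon> \<le> l" by (auto simp: l_def)
  define f where "f x = l / I * S (l * x)" for x
  have scale: "integrable lborel (\<lambda>x. u (l * x))" "(\<integral>x. u (l * x) \<partial>lborel) = (\<integral>x. u x \<partial>lborel) / l"
    if "integrable lborel u" for u :: "real \<Rightarrow> real"
    using lborel_integrable_real_affine[OF that, of l 0] lborel_integral_real_affine[of l u 0] l
    by auto
  have f0: "0 \<le> f x" for x using l I S0 by (simp add: f_def)
  have Wl: "W x * f x \<le> (1 / I) * (W (l * x) * S (l * x))" for x
  proof -
    have "\<bar>l * x\<bar> powr q = l powr q * \<bar>x\<bar> powr q"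
      using l by (simp add: abs_mult powr_mult)
    moreover have "l \<le> l powr q"
      using powr_mono[of 1 q l] l q by simp
    ultimately have "l * W x \<le> W (l * x)"
      using l by (simp add: W_def abs_mult distrib_left mult_right_mono)
    then have "(1 / I) * ((l * W x) * S (l * x)) \<le> (1 / I) * (W (l * x) * S (l * x))"
      using I S0 by (intro mult_left_mono mult_right_mono) auto
    then show ?thesis by (simp add: f_def field_simps)
  qed
  have iWf': "integrable lborel (\<lambda>x. (1 / I) * (W (l * x) * S (l * x)))"
    by (intro integrable_mult_right scale(1)[OF iWS])
  have fm: "f \<in> borel_measurable borel" unfolding f_def[abs_def] by measurable
  note fm[measurable]
  have iWf: "integrable lborel (\<lambda>x. W x * f x)"
  proof (rule Bochner_Integration.integrable_bound[OF iWf'])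
    have "norm (W x * f x) \<le> norm ((1 / I) * (W (l * x) * S (l * x)))" for x
      using Wl[of x] mult_nonneg_nonneg[OF W0[of x] f0[of x]]
        abs_ge_self[of "(1 / I) * (W (l * x) * S (l * x))"]
      unfolding real_norm_def by linarith
    then show "AE x in lborel. norm (W x * f x) \<le> norm ((1 / I) * (W (l * x) * S (l * x)))"
      by (intro AE_I2)
  qed simp
  show ?thesis
  proof (rule that[of f "real (2 * m) * l" "l / I"])
    show "f \<in> borel_measurable borel" by fact
    show "0 \<le> f x" for x by (rule f0)
    show "f (- x) = f x" for x by (simp add: f_def S_def)
    show "isCont f 0"
      unfolding f_def[abs_def] using contS
      by (intro continuous_mult continuous_const isCont_o2[where g = S and f = "\<lambda>x. l * x"] continuous_ident) simp_all
    show "f 0 > 0" using l I Spos by (simp add: f_def)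
    show "integrable lborel f"
      unfolding f_def[abs_def] by (intro integrable_mult_right scale(1)[OF iS])
    show "(\<integral>x. f x \<partial>lborel) = 1"
      unfolding f_def[abs_def] using l I by (simp add: scale(2)[OF iS] I_def[symmetric])
    show "integrable lborel (\<lambda>x. (\<bar>x\<bar> + \<bar>x\<bar> powr q) * f x)"
      using iWf by (simp add: W_def)
    have "(\<integral>x. W x * f x \<partial>lborel) \<le> (\<integral>x. (1 / I) * (W (l * x) * S (l * x)) \<partial>lborel)"
      by (intro integral_mono iWf iWf' Wl)
    also have "\<dots> = J / l"
      using scale(2)[OF iWS] by (simp add: J_def)
    also have "\<dots> \<le> \<epsilon>"
      using l \<epsilon> by (simp add: field_simps)
    finally show "(\<integral>x. (\<bar>x\<bar> + \<bar>x\<bar> powr q) * f x \<partial>lborel) \<le> \<epsilon>"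
      by (simp add: W_def)
    show "band_limited f (real (2 * m) * l) (l / I)"
      unfolding band_limited_def
    proof (intro allI impI)
      fix g :: "real \<Rightarrow> real" and s0 \<rho> s y :: real
      assume "integrable lborel g" and "\<forall>w. s0 \<le> \<bar>w\<bar> \<longrightarrow> cmod (fourier g w) \<le> \<rho>"
        and "s0 + real (2 * m) * l \<le> \<bar>s\<bar>"
      then have le: "cmod (\<integral>x. exp (\<i> * of_real (s * x)) * of_real (card_sine (l * x) ^ (2 * m) * g (y - x)) \<partial>lborel) \<le> \<rho>"
        by (intro norm_integral_card_sine_power_le[where ?s0.0 = s0] l(2)) auto
      have "(\<integral>x. exp (\<i> * of_real (s * x)) * of_real (f x * g (y - x)) \<partial>lborel)
          = (\<integral>x. of_real (l / I) * (exp (\<i> * of_real (s * x)) * of_real (card_sine (l * x) ^ (2 * m) * g (y - x))) \<partial>lborel)"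
        by (intro Bochner_Integration.integral_cong refl) (simp add: f_def S_def)
      also have "\<dots> = of_real (l / I) * (\<integral>x. exp (\<i> * of_real (s * x)) * of_real (card_sine (l * x) ^ (2 * m) * g (y - x)) \<partial>lborel)"
        by (rule integral_mult_right_zero)
      also have "cmod \<dots> = l / I * cmod (\<integral>x. exp (\<i> * of_real (s * x)) * of_real (card_sine (l * x) ^ (2 * m) * g (y - x)) \<partial>lborel)"
        using l I by (simp only: norm_mult norm_of_real) simp
      also have "\<dots> \<le> l / I * \<rho>"
        using l I by (intro mult_left_mono le) auto
      finally show "cmod (\<integral>x. exp (\<i> * of_real (s * x)) * of_real (f x * g (y - x)) \<partial>lborel) \<le> l / I * \<rho>" .
    qed
    show "l / I \<ge> 0" using l I by simp
  qed
qed

section \<open>Smoothing an oscillating perturbation by the noise\<close>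

text \<open>
Moments of order 1/2 are used for tails: the square root is subadditive, so that the weight of a sum
is controlled by the weights of the summands, and it grows slowly enough for the moment to be finite
under a small-ball exponent of 5/2.
\<close>

definition weight :: "real \<Rightarrow> real" where
  "weight x = sqrt (1 + \<bar>x\<bar>)"

lemma weight_measurable[measurable]: "weight \<in> borel_measurable borel"
  unfolding weight_def[abs_def] by measurable

lemma weight_nonneg: "0 \<le> weight x"
  by (simp add: weight_def)

lemma weight_add: "weight (x + y) \<le> weight x + weight y"
proof -
  have "sqrt (1 + \<bar>x + y\<bar>) \<le> sqrt ((1 + \<bar>x\<bar>) + (1 + \<bar>y\<bar>))"
    by (intro real_sqrt_le_mono) simp
  also have "\<dots> \<le> sqrt (1 + \<bar>x\<bar>) + sqrt (1 + \<bar>y\<bar>)"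
    by (rule sqrt_add_le_add_sqrt) auto
  finally show ?thesis by (simp add: weight_def)
qed

lemma weight_shift_le:
  assumes "\<bar>x - t\<bar> \<le> 1" shows "weight x \<le> 2 * weight t"
proof -
  have "sqrt (1 + \<bar>x\<bar>) \<le> sqrt (2\<^sup>2 * (1 + \<bar>t\<bar>))"
    using assms by (intro real_sqrt_le_mono) (auto simp: abs_if split: if_splits)
  also have "\<dots> = 2 * weight t"
    by (simp only: real_sqrt_mult real_sqrt_abs weight_def abs_numeral)
  finally show ?thesis by (simp only: weight_def)
qed

text \<open>
Small-ball probabilities that decay in the centre t of the ball bound the tails.  For t in the unit
ball around x, an interval of length 2, weight x is at most 2 weight t; so weight x is at most the
integral of weight t over this ball.  Tonelli then bounds the moment by the integral of weight t
times the probability of the unit ball around t.  That integrand decays like |t|^(1/2 - 5/2), since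
for |t| at least 1 the unit ball lies in the ball of radius |t|^\<kappa>1.
\<close>

lemma nn_integral_weight_finite:
  fixes N :: "real measure"
  assumes "prob_space N" and [measurable_cong]: "sets N = sets borel"
    and k1: "\<kappa>1 > 0" and k2: "\<kappa>2 \<ge> 5 / 2"
    and O: "(\<lambda>t. measure N {x. \<bar>x - t\<bar> \<le> \<bar>t\<bar> powr \<kappa>1}) \<in> O[at_infinity](\<lambda>t. \<bar>t\<bar> powr (- \<kappa>2))"
  shows "(\<integral>\<^sup>+x. ennreal (weight x) \<partial>N) < \<top>"
proof -
  interpret N: prob_space N by fact
  interpret pair_sigma_finite lborel N by standard
  define m where "m t = measure N {x. \<bar>x - t\<bar> \<le> 1}" for t
  have m01: "0 \<le> m t" "m t \<le> 1" for t by (auto simp: m_def)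
  have spN: "space N = UNIV"
    using sets_eq_imp_space_eq[OF assms(2)] by simp
  obtain c where c: "c > 0"
    and "eventually (\<lambda>t. norm (measure N {x. \<bar>x - t\<bar> \<le> \<bar>t\<bar> powr \<kappa>1}) \<le> c * norm (\<bar>t\<bar> powr (- \<kappa>2))) at_infinity"
    using O by (rule landau_o.bigE)
  then obtain T0 where T0: "\<And>t. T0 \<le> \<bar>t\<bar> \<Longrightarrow>
      measure N {x. \<bar>x - t\<bar> \<le> \<bar>t\<bar> powr \<kappa>1} \<le> c * \<bar>t\<bar> powr (- \<kappa>2)"
    unfolding eventually_at_infinity by auto
  define T where "T = max 1 T0"
  define K where "K = 4 * c + sqrt (1 + T) * (1 + T\<^sup>2)"
  have m_tail: "m t \<le> c * \<bar>t\<bar> powr (- (5 / 2))" if "T \<le> \<bar>t\<bar>" for t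
  proof -
    have t: "1 \<le> \<bar>t\<bar>" "T0 \<le> \<bar>t\<bar>" using that by (auto simp: T_def)
    have "1 \<le> \<bar>t\<bar> powr \<kappa>1" using t k1 by (intro ge_one_powr_ge_zero) auto
    then have "m t \<le> measure N {x. \<bar>x - t\<bar> \<le> \<bar>t\<bar> powr \<kappa>1}"
      unfolding m_def by (intro N.finite_measure_mono) auto
    also have "\<dots> \<le> c * \<bar>t\<bar> powr (- \<kappa>2)" by (rule T0) fact
    also have "\<dots> \<le> c * \<bar>t\<bar> powr (- (5 / 2))"
      using c t k2 by (intro mult_left_mono powr_mono) auto
    finally show ?thesis .
  qed
  have wm: "weight t * m t \<le> K * inverse (1 + t\<^sup>2)" for t
  proof (cases "T \<le> \<bar>t\<bar>")
    case True
    then have t: "1 \<le> \<bar>t\<bar>" by (simp add: T_def)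
    have "weight t \<le> sqrt (2\<^sup>2 * \<bar>t\<bar>)"
      unfolding weight_def using t by (intro real_sqrt_le_mono) simp
    also have "\<dots> = 2 * \<bar>t\<bar> powr (1 / 2)"
      by (simp add: real_sqrt_mult powr_half_sqrt)
    finally have "weight t * m t \<le> (2 * \<bar>t\<bar> powr (1 / 2)) * (c * \<bar>t\<bar> powr (- (5 / 2)))"
      using m_tail[OF True] m01 by (intro mult_mono) auto
    also have "\<dots> = 2 * c * \<bar>t\<bar> powr (- 2)"
      by (simp add: powr_add[symmetric])
    also have "\<dots> = 2 * c / t\<^sup>2"
      using t by (simp add: powr_minus powr_numeral divide_inverse)
    also have "\<dots> \<le> 4 * c * inverse (1 + t\<^sup>2)"
    proof -
      have "1 \<le> t\<^sup>2" using t by (metis abs_1 abs_le_square_iff one_power2)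
      then have "1 + t\<^sup>2 \<le> 2 * t\<^sup>2" "t\<^sup>2 > 0" "1 + t\<^sup>2 > 0" by auto
      then show ?thesis using c by (simp add: divide_simps)
    qed
    also have "\<dots> \<le> K * inverse (1 + t\<^sup>2)"
      unfolding K_def by (intro mult_right_mono) (auto simp: T_def)
    finally show ?thesis .
  next
    case False
    have "weight t * m t \<le> sqrt (1 + T) * 1"
      using False m01 unfolding weight_def by (intro mult_mono) auto
    also have "\<dots> \<le> sqrt (1 + T) * ((1 + T\<^sup>2) * inverse (1 + t\<^sup>2))"
    proof (intro mult_left_mono)
      have "t\<^sup>2 \<le> T\<^sup>2"
        using False by (subst abs_le_square_iff[symmetric]) auto
      then show "1 \<le> (1 + T\<^sup>2) * inverse (1 + t\<^sup>2)"
        by (simp add: divide_inverse[symmetric] le_divide_eq add_pos_nonneg)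
    qed (simp add: T_def)
    also have "\<dots> \<le> K * inverse (1 + t\<^sup>2)"
      unfolding K_def mult.assoc[symmetric] using c by (intro mult_right_mono) auto
    finally show ?thesis .
  qed
  have "(\<integral>\<^sup>+x. ennreal (weight x) \<partial>N)
      \<le> (\<integral>\<^sup>+x. (\<integral>\<^sup>+t. ennreal (weight t) * indicator {z. \<bar>fst z - snd z\<bar> \<le> 1} (x, t) \<partial>lborel) \<partial>N)"
  proof (intro nn_integral_mono)
    fix x
    have "ennreal (weight x) = ennreal (weight x / 2) * emeasure lborel {x - 1..x + 1}"
      using weight_nonneg[of x] by (simp add: ennreal_mult[symmetric] flip: ennreal_numeral)
    also have "\<dots> = (\<integral>\<^sup>+t. ennreal (weight x / 2) * indicator {x - 1..x + 1} t \<partial>lborel)"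
      by (simp add: nn_integral_cmult)
    also have "\<dots> \<le> (\<integral>\<^sup>+t. ennreal (weight t) * indicator {z. \<bar>fst z - snd z\<bar> \<le> 1} (x, t) \<partial>lborel)"
      by (intro nn_integral_mono) (auto simp: indicator_def intro!: ennreal_leI dest!: weight_shift_le[of x])
    finally show "ennreal (weight x) \<le> \<dots>" .
  qed
  also have "\<dots> = (\<integral>\<^sup>+t. (\<integral>\<^sup>+x. ennreal (weight t) * indicator {z. \<bar>fst z - snd z\<bar> \<le> 1} (x, t) \<partial>N) \<partial>lborel)"
    by (rule Fubini') measurable
  also have "\<dots> = (\<integral>\<^sup>+t. ennreal (weight t * m t) \<partial>lborel)"
  proof (intro nn_integral_cong)
    fix t
    have "(\<integral>\<^sup>+x. ennreal (weight t) * indicator {z. \<bar>fst z - snd z\<bar> \<le> 1} (x, t) \<partial>N)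
        = (\<integral>\<^sup>+x. ennreal (weight t) * indicator {x. \<bar>x - t\<bar> \<le> 1} x \<partial>N)"
      by (intro nn_integral_cong) (auto simp: indicator_def)
    also have "\<dots> = ennreal (weight t * m t)"
      by (subst nn_integral_cmult)
        (auto simp: m_def N.emeasure_eq_measure ennreal_mult weight_nonneg)
    finally show "(\<integral>\<^sup>+x. ennreal (weight t) * indicator {z. \<bar>fst z - snd z\<bar> \<le> 1} (x, t) \<partial>N) = \<dots>" .
  qed
  also have "\<dots> \<le> (\<integral>\<^sup>+t. ennreal (K * inverse (1 + t\<^sup>2)) \<partial>lborel)"
    by (intro nn_integral_mono ennreal_leI wm)
  also have "\<dots> < \<top>"
  proof -
    have "integrable lborel (\<lambda>t::real. K * inverse (1 + t\<^sup>2))"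
      by (intro integrable_mult_right integrable_inverse_1_plus_square_lborel)
    moreover have "K \<ge> 0" using c by (simp add: K_def T_def)
    ultimately show ?thesis
      by (subst nn_integral_eq_integral) (auto simp: add_nonneg_nonneg)
  qed
  finally show ?thesis .
qed

text \<open>
The double integral of |k(z) g(y - z)| is the product of the two L1 norms.
\<close>

lemma integrable_translation_kernel:
  fixes k g :: "real \<Rightarrow> real"
  assumes k: "integrable lborel k" and g: "integrable lborel g"
  shows "integrable (lborel \<Otimes>\<^sub>M lborel) (\<lambda>(z, y). k z * g (y - z))"
proof (rule lborel_pair.Fubini_integrable)
  have [measurable]: "k \<in> borel_measurable borel" "g \<in> borel_measurable borel"
    using borel_measurable_integrable[OF k] borel_measurable_integrable[OF g] by auto
  show "(\<lambda>(z, y). k z * g (y - z)) \<in> borel_measurable (lborel \<Otimes>\<^sub>M lborel)"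
    by measurable
  have gz: "integrable lborel (\<lambda>y. g (y - z))" "(\<integral>y. \<bar>g (y - z)\<bar> \<partial>lborel) = (\<integral>y. \<bar>g y\<bar> \<partial>lborel)" for z
    using lborel_integrable_real_affine[OF g, of 1 "- z"]
      lborel_integral_real_affine[of 1 "\<lambda>y. \<bar>g y\<bar>" "- z"] by auto
  show "integrable lborel (\<lambda>z. \<integral>y. norm (case (z, y) of (z, y) \<Rightarrow> k z * g (y - z)) \<partial>lborel)"
    using k by (simp add: abs_mult gz(2))
  show "AE z in lborel. integrable lborel (\<lambda>y. case (z, y) of (z, y) \<Rightarrow> k z * g (y - z))"
    using gz(1) by simp
qed

text \<open>
By Fubini the left-hand side is the integral of u against the convolution of k and g, so \<eta>, a
bound on the L1 norm of the convolution, bounds it for every test function u.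
\<close>

lemma convolution_test_le:
  fixes k g u :: "real \<Rightarrow> real"
  assumes k: "integrable lborel k" and g: "integrable lborel g"
    and [measurable]: "u \<in> borel_measurable borel" and u: "\<And>x. 0 \<le> u x \<and> u x \<le> 1"
    and \<eta>: "(\<integral>\<^sup>+y. ennreal \<bar>\<integral>z. k z * g (y - z) \<partial>lborel\<bar> \<partial>lborel) \<le> ennreal \<eta>" "\<eta> \<ge> 0"
  shows "\<bar>\<integral>z. k z * (\<integral>x. u (z + x) * g x \<partial>lborel) \<partial>lborel\<bar> \<le> \<eta>"
proof -
  have [measurable]: "k \<in> borel_measurable borel" "g \<in> borel_measurable borel"
    using borel_measurable_integrable[OF k] borel_measurable_integrable[OF g] by auto
  define h where "h y = (\<integral>z. k z * g (y - z) \<partial>lborel)" for y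
  have [measurable]: "h \<in> borel_measurable borel" unfolding h_def by measurable
  have int: "integrable (lborel \<Otimes>\<^sub>M lborel) (\<lambda>(z, y). u y * (k z * g (y - z)))"
  proof (rule Bochner_Integration.integrable_bound[OF integrable_translation_kernel[OF k g]])
    show "AE x in lborel \<Otimes>\<^sub>M lborel. norm (case x of (z, y) \<Rightarrow> u y * (k z * g (y - z)))
        \<le> norm (case x of (z, y) \<Rightarrow> k z * g (y - z))"
      using u by (intro AE_I2) (auto simp: abs_mult intro!: mult_left_le_one_le)
  qed measurable
  have "(\<integral>z. k z * (\<integral>x. u (z + x) * g x \<partial>lborel) \<partial>lborel)
      = (\<integral>z. (\<integral>y. u y * (k z * g (y - z)) \<partial>lborel) \<partial>lborel)"
  proof (intro Bochner_Integration.integral_cong refl)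
    fix z
    have "(\<integral>x. u (z + x) * g x \<partial>lborel) = (\<integral>y. u y * g (y - z) \<partial>lborel)"
      by (subst lborel_integral_real_affine[where c = 1 and t = "- z"]) (auto simp: algebra_simps)
    then have "k z * (\<integral>x. u (z + x) * g x \<partial>lborel) = (\<integral>y. k z * (u y * g (y - z)) \<partial>lborel)"
      by simp
    then show "k z * (\<integral>x. u (z + x) * g x \<partial>lborel) = (\<integral>y. u y * (k z * g (y - z)) \<partial>lborel)"
      by (simp add: mult_ac)
  qed
  also have "\<dots> = (\<integral>y. (\<integral>z. u y * (k z * g (y - z)) \<partial>lborel) \<partial>lborel)"
    using lborel_pair.Fubini_integral[OF int] by simp
  also have "\<dots> = (\<integral>y. u y * h y \<partial>lborel)"
    by (simp add: h_def)
  finally have eq: "(\<integral>z. k z * (\<integral>x. u (z + x) * g x \<partial>lborel) \<partial>lborel) = (\<integral>y. u y * h y \<partial>lborel)" .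
  have "integrable lborel (\<lambda>y. \<integral>z. u y * (k z * g (y - z)) \<partial>lborel)"
    using lborel_pair.integrable_snd[OF int] by simp
  then have iuh: "integrable lborel (\<lambda>y. u y * h y)" by (simp add: h_def)
  have "ennreal \<bar>\<integral>y. u y * h y \<partial>lborel\<bar> \<le> (\<integral>\<^sup>+y. ennreal \<bar>u y * h y\<bar> \<partial>lborel)"
    using integral_norm_bound_ennreal[OF iuh] by simp
  also have "\<dots> \<le> (\<integral>\<^sup>+y. ennreal \<bar>h y\<bar> \<partial>lborel)"
    using u by (intro nn_integral_mono ennreal_leI) (auto simp: abs_mult intro!: mult_left_le_one_le)
  also have "\<dots> \<le> ennreal \<eta>" using \<eta>(1) by (simp add: h_def)
  finally show ?thesis using \<eta>(2) eq by simp
qed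

text \<open>
On [-R,R] the convolution is bounded by its supremum C \<rho>, which is small because f is
band-limited and b is far from the frequencies where the transform of g is large.  Outside, it is
dominated by the density of Z + \<epsilon>', where Z has density f and \<epsilon>' has density g, and
Markov's inequality with the weight applies.
\<close>

lemma nn_integral_perturbation_le:
  fixes f g :: "real \<Rightarrow> real"
  assumes f: "integrable lborel f" "\<And>x. 0 \<le> f x" "(\<integral>x. f x \<partial>lborel) = 1"
    and g: "integrable lborel g" "\<And>x. 0 \<le> g x" "(\<integral>x. g x \<partial>lborel) = 1"
    and bl: "band_limited f \<Lambda> C" and C: "C \<ge> 0"
    and dec: "\<And>w. \<bar>w\<bar> \<ge> s0 \<Longrightarrow> cmod (fourier g w) \<le> \<rho>" and \<rho>: "\<rho> \<ge> 0"
    and b: "b \<ge> s0 + \<Lambda>" "b \<ge> 0" and R: "R > 0"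
  shows "(\<integral>\<^sup>+y. ennreal \<bar>\<integral>z. (f z * sin (b * z)) * g (y - z) \<partial>lborel\<bar> \<partial>lborel)
    \<le> ennreal (2 * R * (C * \<rho>)) + ennreal (1 / sqrt R) *
      ((\<integral>\<^sup>+x. ennreal (weight x * f x) \<partial>lborel) + (\<integral>\<^sup>+x. ennreal (weight x * g x) \<partial>lborel))"
proof -
  have [measurable]: "f \<in> borel_measurable borel" "g \<in> borel_measurable borel"
    using borel_measurable_integrable[OF f(1)] borel_measurable_integrable[OF g(1)] by auto
  define h where "h y = (\<integral>z. (f z * sin (b * z)) * g (y - z) \<partial>lborel)" for y
  have [measurable]: "h \<in> borel_measurable borel" unfolding h_def by measurable
  have f1: "(\<integral>\<^sup>+z. ennreal (f z) \<partial>lborel) = 1"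
    using nn_integral_eq_integral[OF f(1)] f by simp
  have g1: "(\<integral>\<^sup>+z. ennreal (g z) \<partial>lborel) = 1"
    using nn_integral_eq_integral[OF g(1)] g by simp
  have sup: "\<bar>h y\<bar> \<le> C * \<rho>" if fg: "integrable lborel (\<lambda>z. f z * g (y - z))" for y
  proof -
    have int: "integrable lborel (\<lambda>z. exp (\<i> * of_real (b * z)) * of_real (f z * g (y - z)))"
      by (rule Bochner_Integration.integrable_bound[OF fg]) (auto simp: norm_mult)
    have "h y = (\<integral>z. Im (exp (\<i> * of_real (b * z)) * of_real (f z * g (y - z))) \<partial>lborel)"
      unfolding h_def by (intro Bochner_Integration.integral_cong refl) (simp add: Im_exp mult_ac)
    also have "\<dots> = Im (\<integral>z. exp (\<i> * of_real (b * z)) * of_real (f z * g (y - z)) \<partial>lborel)"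
      using int by (rule integral_Im)
    also have "\<bar>\<dots>\<bar> \<le> cmod (\<integral>z. exp (\<i> * of_real (b * z)) * of_real (f z * g (y - z)) \<partial>lborel)"
      by (rule abs_Im_le_cmod)
    also have "\<dots> \<le> C * \<rho>"
    proof -
      have "s0 + \<Lambda> \<le> \<bar>b\<bar>" using b by simp
      then show ?thesis using bl g(1) dec unfolding band_limited_def by blast
    qed
    finally show ?thesis .
  qed
  \<comment> \<open>The supremum bound is only needed for almost every \<open>y\<close>: the integrand may fail to be
    integrable on a null set.\<close>
  have AE_int: "AE y in lborel. integrable lborel (\<lambda>z. f z * g (y - z))"
    using lborel_pair.AE_integrable_snd[OF integrable_translation_kernel[OF f(1) g(1)]] by simp
  have tail: "ennreal \<bar>h y\<bar> \<le> (\<integral>\<^sup>+z. ennreal (f z * g (y - z)) \<partial>lborel)" for y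
  proof (cases "integrable lborel (\<lambda>z. (f z * sin (b * z)) * g (y - z))")
    case True
    have "ennreal \<bar>h y\<bar> \<le> (\<integral>\<^sup>+z. ennreal \<bar>(f z * sin (b * z)) * g (y - z)\<bar> \<partial>lborel)"
      using integral_norm_bound_ennreal[OF True] by (simp add: h_def)
    also have "\<dots> \<le> (\<integral>\<^sup>+z. ennreal (f z * g (y - z)) \<partial>lborel)"
      using f(2) g(2)
      by (intro nn_integral_mono ennreal_leI) (auto simp: abs_mult intro!: mult_right_mono mult_right_le_one_le)
    finally show ?thesis .
  qed (simp add: h_def not_integrable_integral_eq)
  have shift: "(\<integral>\<^sup>+y. u y * ennreal (g (y - z)) \<partial>lborel) = (\<integral>\<^sup>+x. u (z + x) * ennreal (g x) \<partial>lborel)"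
    if [measurable]: "u \<in> borel_measurable borel" for z and u :: "real \<Rightarrow> ennreal"
    by (subst nn_integral_real_affine[where c = 1 and t = z]) auto
  have sqrtR: "1 \<le> 1 / sqrt R * weight y" if "R < \<bar>y\<bar>" for y
    using that R by (simp add: weight_def le_divide_eq)
  have "(\<integral>\<^sup>+y. (\<integral>\<^sup>+z. ennreal (weight y) * ennreal (f z * g (y - z)) \<partial>lborel) \<partial>lborel)
      = (\<integral>\<^sup>+z. (\<integral>\<^sup>+y. ennreal (weight y) * ennreal (f z * g (y - z)) \<partial>lborel) \<partial>lborel)"
    by (rule lborel_pair.Fubini') measurable
  also have "\<dots> = (\<integral>\<^sup>+z. ennreal (f z) * (\<integral>\<^sup>+y. ennreal (weight y) * ennreal (g (y - z)) \<partial>lborel) \<partial>lborel)"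
    using f(2) g(2) by (simp add: ennreal_mult nn_integral_cmult[symmetric] mult_ac)
  also have "\<dots> \<le> (\<integral>\<^sup>+z. ennreal (f z) * (ennreal (weight z) + (\<integral>\<^sup>+x. ennreal (weight x * g x) \<partial>lborel)) \<partial>lborel)"
  proof (intro nn_integral_mono mult_left_mono)
    fix z
    have "(\<integral>\<^sup>+y. ennreal (weight y) * ennreal (g (y - z)) \<partial>lborel) = (\<integral>\<^sup>+x. ennreal (weight (z + x)) * ennreal (g x) \<partial>lborel)"
      by (rule shift) measurable
    also have "\<dots> \<le> (\<integral>\<^sup>+x. ennreal (weight z) * ennreal (g x) + ennreal (weight x * g x) \<partial>lborel)"
      using g(2) weight_nonneg
      by (intro nn_integral_mono)
        (auto simp: ennreal_mult[symmetric] ennreal_plus[symmetric] distrib_right[symmetric]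
          simp del: ennreal_plus intro!: ennreal_leI mult_right_mono weight_add)
    also have "\<dots> = ennreal (weight z) + (\<integral>\<^sup>+x. ennreal (weight x * g x) \<partial>lborel)"
      by (simp add: nn_integral_add nn_integral_cmult g1)
    finally show "(\<integral>\<^sup>+y. ennreal (weight y) * ennreal (g (y - z)) \<partial>lborel) \<le> \<dots>" .
  qed simp
  also have "\<dots> = (\<integral>\<^sup>+z. ennreal (weight z * f z) \<partial>lborel) + (\<integral>\<^sup>+x. ennreal (weight x * g x) \<partial>lborel)"
    using f(2) weight_nonneg
    by (simp add: distrib_left nn_integral_add nn_integral_multc f1 ennreal_mult mult.commute)
  finally have inner: "(\<integral>\<^sup>+y. (\<integral>\<^sup>+z. ennreal (weight y) * ennreal (f z * g (y - z)) \<partial>lborel) \<partial>lborel)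
      \<le> (\<integral>\<^sup>+z. ennreal (weight z * f z) \<partial>lborel) + (\<integral>\<^sup>+x. ennreal (weight x * g x) \<partial>lborel)" .
  have "(\<integral>\<^sup>+y. ennreal \<bar>h y\<bar> \<partial>lborel)
      \<le> (\<integral>\<^sup>+y. ennreal (C * \<rho>) * indicator {-R..R} y +
          ennreal (1 / sqrt R) * (\<integral>\<^sup>+z. ennreal (weight y) * ennreal (f z * g (y - z)) \<partial>lborel) \<partial>lborel)"
  proof (rule nn_integral_mono_AE, rule AE_mp[OF AE_int], rule AE_I2, rule impI)
    fix y
    assume fg: "integrable lborel (\<lambda>z. f z * g (y - z))"
    show "ennreal \<bar>h y\<bar> \<le> ennreal (C * \<rho>) * indicator {-R..R} y +
          ennreal (1 / sqrt R) * (\<integral>\<^sup>+z. ennreal (weight y) * ennreal (f z * g (y - z)) \<partial>lborel)"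
    proof (cases "y \<in> {-R..R}")
      case True
      then show ?thesis using sup[OF fg] by (simp add: ennreal_leI add_increasing2)
    next
      case False
      then have "R < \<bar>y\<bar>" by auto
      have "ennreal \<bar>h y\<bar> \<le> ennreal (1 / sqrt R * weight y) * (\<integral>\<^sup>+z. ennreal (f z * g (y - z)) \<partial>lborel)"
        using mult_mono[OF ennreal_leI[OF sqrtR[OF \<open>R < \<bar>y\<bar>\<close>]] tail[of y]] by simp
      also have "\<dots> = ennreal (1 / sqrt R) * (\<integral>\<^sup>+z. ennreal (weight y) * ennreal (f z * g (y - z)) \<partial>lborel)"
        using ennreal_mult[of "1 / sqrt R" "weight y"] R weight_nonneg[of y]
        by (simp only: mult.assoc) (simp add: nn_integral_cmult mult.assoc)
      finally show ?thesis using False by simp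
    qed
  qed
  also have "\<dots> = ennreal (C * \<rho>) * ennreal (2 * R) + ennreal (1 / sqrt R) *
      (\<integral>\<^sup>+y. (\<integral>\<^sup>+z. ennreal (weight y) * ennreal (f z * g (y - z)) \<partial>lborel) \<partial>lborel)"
    using R by (simp add: nn_integral_add nn_integral_cmult)
  also have "\<dots> \<le> ennreal (C * \<rho>) * ennreal (2 * R) + ennreal (1 / sqrt R) *
      ((\<integral>\<^sup>+z. ennreal (weight z * f z) \<partial>lborel) + (\<integral>\<^sup>+x. ennreal (weight x * g x) \<partial>lborel))"
    by (intro add_left_mono mult_left_mono inner) simp
  also have "ennreal (C * \<rho>) * ennreal (2 * R) = ennreal (2 * R * (C * \<rho>))"
    using C \<rho> R by (simp add: ennreal_mult[symmetric] mult.commute)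
  finally show ?thesis by (simp only: h_def)
qed

section \<open>Oscillating perturbations along one coordinate\<close>

text \<open>
The point whose image under A is z times the j-th unit vector.
\<close>

definition axis_point :: "real^'d^'d \<Rightarrow> 'd \<Rightarrow> real \<Rightarrow> real^'d" where
  "axis_point A j z = z *\<^sub>R (matrix_inv A *v axis j 1)"

text \<open>
For \<sigma> between -1 and 1 the factor 1 + \<sigma> sin(b z) is nonnegative, and for even f the
oscillating part has total mass 0, so this is again a probability measure.
\<close>

definition perturbed :: "real^'d^'d \<Rightarrow> 'd \<Rightarrow> (real \<Rightarrow> real) \<Rightarrow> real \<Rightarrow> real \<Rightarrow> (real^'d) measure" where
  "perturbed A j f b \<sigma> = distr (density lborel (\<lambda>z. ennreal (f z * (1 + \<sigma> * sin (b * z))))) borel (axis_point A j)"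

lemma distr_borel_eq_density:
  assumes "distributed M lborel X h"
  shows "distr M borel X = density lborel h"
proof -
  have "distr M borel X = distr M lborel X"
    by (rule distr_cong) auto
  then show ?thesis
    using assms by (simp add: distributed_def)
qed

lemma coordinate_measurable[measurable]:
  fixes A :: "real^'n^'m"
  shows "(\<lambda>x. (A *v x) $ i) \<in> borel_measurable borel"
  by (intro borel_measurable_continuous_onI continuous_on_component linear_continuous_on)
    (simp add: matrix_vector_mul_bounded_linear)

lemma axis_point_measurable[measurable]: "axis_point A j \<in> borel_measurable borel"
  unfolding axis_point_def[abs_def] by measurable

lemma matrix_inv_cancel:
  assumes "invertible A"
  shows "A ** matrix_inv A = mat 1" "matrix_inv A ** A = mat 1"
  using someI_ex[OF assms[unfolded invertible_def]] by (simp_all add: matrix_inv_def)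

lemma coordinate_axis_point:
  fixes A :: "real^'d^'d"
  assumes "invertible A"
  shows "(A *v axis_point A j z) $ i = (if i = j then z else 0)"
  by (simp add: axis_point_def matrix_vector_mult_scaleR matrix_vector_mul_assoc
      matrix_inv_cancel[OF assms] axis_def)

text \<open>
Used to separate coordinate j0 of A x from the others inside a function of x.
\<close>

lemma sum_axis_point:
  fixes A :: "real^'d^'d"
  assumes "invertible A"
  shows "x = (\<Sum>i\<in>UNIV. axis_point A i ((A *v x) $ i))"
proof -
  have "x = matrix_inv A *v (A *v x)"
    by (simp add: matrix_vector_mul_assoc matrix_inv_cancel[OF assms])
  also have "\<dots> = (\<Sum>i\<in>UNIV. ((A *v x) $ i) *s column i (matrix_inv A))"
    by (rule matrix_mult_sum)
  finally show ?thesis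
    by (simp add: axis_point_def scalar_mult_eq_scaleR matrix_vector_mult_basis)
qed

locale perturbation =
  fixes f :: "real \<Rightarrow> real" and b :: real
  assumes f_int: "integrable lborel f" and f_nonneg: "\<And>x. 0 \<le> f x"
    and f_even: "\<And>x. f (- x) = f x" and f_one: "(\<integral>x. f x \<partial>lborel) = 1"
begin

lemma f_measurable[measurable]: "f \<in> borel_measurable borel"
  using borel_measurable_integrable[OF f_int] by simp

lemma integrable_f_mult:
  assumes [measurable]: "u \<in> borel_measurable borel" and "\<And>x. \<bar>u x\<bar> \<le> B"
  shows "integrable lborel (\<lambda>z. f z * u z)"
proof (rule Bochner_Integration.integrable_bound[OF integrable_mult_right[OF f_int, of B]])
  have "\<bar>u x\<bar> * \<bar>f x\<bar> \<le> B * \<bar>f x\<bar>" for x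
    using assms(2)[of x] by (intro mult_right_mono) auto
  moreover have "0 \<le> B" using assms(2)[of 0] by linarith
  ultimately show "AE x in lborel. norm (f x * u x) \<le> norm (B * f x)"
    by (auto simp: abs_mult mult.commute)
qed simp

lemma integral_f_sin: "(\<integral>z. f z * sin (b * z) \<partial>lborel) = 0"
proof -
  have "(\<integral>z. f z * sin (b * z) \<partial>lborel) = (\<integral>z. - (f z * sin (b * z)) \<partial>lborel)"
    by (subst lborel_integral_real_affine[where c = "-1" and t = 0]) (auto simp: f_even)
  then show ?thesis by simp
qed

lemma integrable_f_sin: "integrable lborel (\<lambda>z. f z * sin (b * z))"
  by (rule integrable_f_mult[where B = 1]) auto

lemma integrable_density:
  "integrable lborel (\<lambda>z. f z * (1 + \<sigma> * sin (b * z)))"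
proof (rule integrable_f_mult[where B = "1 + \<bar>\<sigma>\<bar>"])
  fix x
  have "\<bar>1 + \<sigma> * sin (b * x)\<bar> \<le> 1 + \<bar>\<sigma>\<bar> * \<bar>sin (b * x)\<bar>"
    by (metis abs_mult abs_one abs_triangle_ineq)
  also have "\<dots> \<le> 1 + \<bar>\<sigma>\<bar>"
    by (simp add: mult_left_le)
  finally show "\<bar>1 + \<sigma> * sin (b * x)\<bar> \<le> 1 + \<bar>\<sigma>\<bar>" .
qed simp

lemma factor_bounds:
  assumes "\<bar>\<sigma>\<bar> \<le> 1"
  shows "0 \<le> 1 + \<sigma> * sin (b * z)" "1 + \<sigma> * sin (b * z) \<le> 2"
proof -
  have "\<bar>\<sigma> * sin (b * z)\<bar> \<le> 1"
    using assms by (simp add: abs_mult mult_le_one)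
  then show "0 \<le> 1 + \<sigma> * sin (b * z)" "1 + \<sigma> * sin (b * z) \<le> 2" by (simp_all add: abs_le_iff)
qed

lemma density_nonneg: "\<bar>\<sigma>\<bar> \<le> 1 \<Longrightarrow> 0 \<le> f z * (1 + \<sigma> * sin (b * z))"
  using factor_bounds f_nonneg by simp

lemma prob_space_perturbed_density:
  assumes "\<bar>\<sigma>\<bar> \<le> 1"
  shows "prob_space (density lborel (\<lambda>z. ennreal (f z * (1 + \<sigma> * sin (b * z)))))"
proof (rule prob_spaceI)
  have "(\<integral>z. f z * (1 + \<sigma> * sin (b * z)) \<partial>lborel) = (\<integral>z. f z + \<sigma> * (f z * sin (b * z)) \<partial>lborel)"
    by (simp add: algebra_simps)
  also have "\<dots> = 1"
    using integrable_f_sin f_int by (simp add: integral_f_sin f_one)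
  finally show "emeasure (density lborel (\<lambda>z. ennreal (f z * (1 + \<sigma> * sin (b * z)))))
      (space (density lborel (\<lambda>z. ennreal (f z * (1 + \<sigma> * sin (b * z)))))) = 1"
    using nn_integral_eq_integral[OF integrable_density[of \<sigma>]] density_nonneg[OF assms]
    by (simp add: emeasure_density)
qed

lemma perturbed_prob_algebra:
  assumes "\<bar>\<sigma>\<bar> \<le> 1"
  shows "perturbed A j f b \<sigma> \<in> space (prob_algebra borel)"
  unfolding perturbed_def space_prob_algebra
  using prob_space.prob_space_distr[OF prob_space_perturbed_density[OF assms], of "axis_point A j" borel]
  by auto

lemma prob_space_perturbed: "\<bar>\<sigma>\<bar> \<le> 1 \<Longrightarrow> prob_space (perturbed A j f b \<sigma>)"
  and sets_perturbed: "sets (perturbed A j f b \<sigma>) = sets borel"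
  using perturbed_prob_algebra[of \<sigma> A j] by (auto simp: space_prob_algebra perturbed_def)

lemma integral_perturbed:
  fixes u :: "real^'d \<Rightarrow> real"
  assumes "\<bar>\<sigma>\<bar> \<le> 1" and [measurable]: "u \<in> borel_measurable borel"
  shows "(\<integral>x. u x \<partial>perturbed A j f b \<sigma>) = (\<integral>z. f z * (1 + \<sigma> * sin (b * z)) * u (axis_point A j z) \<partial>lborel)"
  unfolding perturbed_def using density_nonneg[OF assms(1)]
  by (subst integral_distr) (auto simp: integral_density)

text \<open>
Under these measures only coordinate j0 of A x is nonzero, so the product in the moment condition
collapses to 1 + |z|^r with r = 2p + a or r = a.  The perturbing factor is at most 2, which is why
the moment of f has to be at most half of M - 1.
\<close>

lemma perturbed_in_moment_class:
  fixes A :: "real^'d^'d"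
  assumes A: "invertible A" and \<sigma>: "\<bar>\<sigma>\<bar> \<le> 1" and a: "a \<ge> 1" and p: "p \<ge> 0"
    and mi: "integrable lborel (\<lambda>x. (\<bar>x\<bar> + \<bar>x\<bar> powr (2 * p + a)) * f x)"
    and mom: "(\<integral>x. (\<bar>x\<bar> + \<bar>x\<bar> powr (2 * p + a)) * f x \<partial>lborel) \<le> (M - 1) / 2"
  shows "perturbed A j0 f b \<sigma> \<in> moment_class A M p a"
proof -
  define W where "W x = \<bar>x\<bar> + \<bar>x\<bar> powr (2 * p + a)" for x :: real
  have W0: "0 \<le> W x" for x by (simp add: W_def)
  have [measurable]: "W \<in> borel_measurable borel" unfolding W_def[abs_def] by measurable
  have miW: "integrable lborel (\<lambda>x. W x * f x)" using mi by (simp add: W_def)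
  let ?D = "density lborel (\<lambda>z. ennreal (f z * (1 + \<sigma> * sin (b * z))))"
  interpret D: prob_space ?D by (rule prob_space_perturbed_density[OF \<sigma>])
  have "(\<integral>\<^sup>+x. ennreal ((1 + \<bar>(A *v x) $ j\<bar> powr (2 * p + a)) *
        (\<Prod>l\<in>UNIV - {j}. 1 + \<bar>(A *v x) $ l\<bar> powr a)) \<partial>perturbed A j0 f b \<sigma>) \<le> ennreal M" for j
  proof -
    have pw: "\<bar>z\<bar> powr r \<le> W z" if r: "1 \<le> r" "r \<le> 2 * p + a" for z r :: real
    proof (cases "\<bar>z\<bar> \<le> 1")
      case True
      then have "\<bar>z\<bar> powr r \<le> \<bar>z\<bar> powr 1"
        using r by (intro powr_mono') auto
      then show ?thesis by (simp add: W_def add_increasing2)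
    next
      case False
      then have "\<bar>z\<bar> powr r \<le> \<bar>z\<bar> powr (2 * p + a)"
        using r by (intro powr_mono) auto
      then show ?thesis by (simp add: W_def add_increasing)
    qed
    have eq: "(1 + \<bar>(A *v axis_point A j0 z) $ j\<bar> powr (2 * p + a)) *
        (\<Prod>l\<in>UNIV - {j}. 1 + \<bar>(A *v axis_point A j0 z) $ l\<bar> powr a) \<le> 1 + W z" for z
    proof (cases "j = j0")
      case True
      have "(\<Prod>l\<in>UNIV - {j}. 1 + \<bar>(A *v axis_point A j0 z) $ l\<bar> powr a) = 1"
        using True by (intro prod.neutral) (auto simp: coordinate_axis_point[OF A])
      then show ?thesis
        using True by (simp add: coordinate_axis_point[OF A] W_def)
    next
      case False
      have "(\<Prod>l\<in>UNIV - {j}. 1 + \<bar>(A *v axis_point A j0 z) $ l\<bar> powr a)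
          = (1 + \<bar>z\<bar> powr a) * (\<Prod>l\<in>UNIV - {j} - {j0}. 1 + \<bar>(A *v axis_point A j0 z) $ l\<bar> powr a)"
        using False by (subst prod.remove[of _ j0]) (auto simp: coordinate_axis_point[OF A])
      also have "(\<Prod>l\<in>UNIV - {j} - {j0}. 1 + \<bar>(A *v axis_point A j0 z) $ l\<bar> powr a) = 1"
        by (intro prod.neutral) (auto simp: coordinate_axis_point[OF A])
      finally show ?thesis
        using False pw[of a z] a p by (simp add: coordinate_axis_point[OF A])
    qed
    have "(\<integral>\<^sup>+z. ennreal (W z) \<partial>?D) \<le> (\<integral>\<^sup>+z. ennreal (2 * (W z * f z)) \<partial>lborel)"
    proof (subst nn_integral_density, simp, simp, intro nn_integral_mono)
      fix z
      have "(f z * (1 + \<sigma> * sin (b * z))) * W z \<le> (f z * 2) * W z"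
        using factor_bounds[OF \<sigma>] f_nonneg W0 by (intro mult_right_mono mult_left_mono) auto
      then show "ennreal (f z * (1 + \<sigma> * sin (b * z))) * ennreal (W z) \<le> ennreal (2 * (W z * f z))"
        using density_nonneg[OF \<sigma>, of z] W0[of z]
        by (simp add: ennreal_mult[symmetric] mult_ac ennreal_leI)
    qed
    also have "(\<integral>\<^sup>+z. ennreal (2 * (W z * f z)) \<partial>lborel) = ennreal (2 * (\<integral>z. W z * f z \<partial>lborel))"
      using nn_integral_eq_integral[OF integrable_mult_right[OF miW, of 2]] W0 f_nonneg by simp
    also have "\<dots> \<le> ennreal (M - 1)"
      using mom by (intro ennreal_leI) (simp add: W_def)
    finally have inner: "(\<integral>\<^sup>+z. ennreal (W z) \<partial>?D) \<le> ennreal (M - 1)" .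
    have "(\<integral>\<^sup>+x. ennreal ((1 + \<bar>(A *v x) $ j\<bar> powr (2 * p + a)) *
        (\<Prod>l\<in>UNIV - {j}. 1 + \<bar>(A *v x) $ l\<bar> powr a)) \<partial>perturbed A j0 f b \<sigma>)
      = (\<integral>\<^sup>+z. ennreal ((1 + \<bar>(A *v axis_point A j0 z) $ j\<bar> powr (2 * p + a)) *
        (\<Prod>l\<in>UNIV - {j}. 1 + \<bar>(A *v axis_point A j0 z) $ l\<bar> powr a)) \<partial>?D)"
      unfolding perturbed_def by (rule nn_integral_distr) measurable
    also have "\<dots> \<le> (\<integral>\<^sup>+z. 1 + ennreal (W z) \<partial>?D)"
      using eq W0 by (intro nn_integral_mono) (simp flip: ennreal_plus ennreal_1)
    also have "\<dots> = 1 + (\<integral>\<^sup>+z. ennreal (W z) \<partial>?D)"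
      using D.emeasure_space_1 by (simp add: nn_integral_add)
    also have "\<dots> \<le> 1 + ennreal (M - 1)"
      by (intro add_left_mono inner)
    also have "1 + ennreal (M - 1) \<le> ennreal M"
    proof -
      have "0 \<le> (\<integral>z. W z * f z \<partial>lborel)" using W0 f_nonneg by simp
      then have "1 \<le> M" using mom by (simp add: W_def)
      then show ?thesis by (simp flip: ennreal_plus ennreal_1)
    qed
    finally show ?thesis .
  qed
  then show ?thesis
    unfolding moment_class_def using perturbed_prob_algebra[OF \<sigma>, of A j0]
    by (auto intro!: SUP_least)
qed

text \<open>
Fix the coordinates of A e other than j0.  A test function of the observation then becomes a
function of z + (A e)_j0 alone, and the two hypotheses give integrals of it that differ by twice its
integral against the convolution of f(z) sin(b z) with g.  By independence this conditional bound
can be averaged over the other coordinates.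
\<close>

lemma observation_test_diff_le:
  fixes A :: "real^'d^'d" and \<mu>_eps :: "(real^'d) measure" and u :: "real^'d \<Rightarrow> real"
  assumes eps: "prob_space \<mu>_eps" and sets_eps[measurable_cong]: "sets \<mu>_eps = sets borel"
    and A: "invertible A"
    and ind: "prob_space.indep_vars \<mu>_eps (\<lambda>_. borel) (\<lambda>j x. (A *v x) $ j) UNIV"
    and g0: "\<And>t. g t \<ge> 0"
    and dist: "distributed \<mu>_eps lborel (\<lambda>x. (A *v x) $ j0) (\<lambda>t. ennreal (g t))"
    and g: "integrable lborel g" "(\<integral>t. g t \<partial>lborel) = 1"
    and um[measurable]: "u \<in> borel_measurable borel" and u: "\<And>x. 0 \<le> u x \<and> u x \<le> 1"
    and \<eta>: "(\<integral>\<^sup>+y. ennreal \<bar>\<integral>z. (f z * sin (b * z)) * g (y - z) \<partial>lborel\<bar> \<partial>lborel) \<le> ennreal \<eta>" "\<eta> \<ge> 0"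
  shows "\<bar>(\<integral>y. u y \<partial>(perturbed A j0 f b 1 \<star> \<mu>_eps)) - (\<integral>y. u y \<partial>(perturbed A j0 f b (-1) \<star> \<mu>_eps))\<bar> \<le> 2 * \<eta>"
proof -
  interpret E: prob_space \<mu>_eps by fact
  have gm[measurable]: "g \<in> borel_measurable borel"
    using borel_measurable_integrable[OF g(1)] by simp
  define X where "X e = (A *v e) $ j0" for e :: "real^'d"
  define V where "V e = restrict (\<lambda>i. (A *v e) $ i) (UNIV - {j0})" for e :: "real^'d"
  define S where "S = PiM (UNIV - {j0}) (\<lambda>_::'d. borel :: real measure)"
  define R where "R = distr \<mu>_eps S V"
  define B where "B r = (\<Sum>i\<in>UNIV - {j0}. axis_point A i (r i))" for r :: "'d \<Rightarrow> real"
  have [measurable]: "X \<in> borel_measurable borel" "V \<in> measurable borel S"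
    unfolding X_def[abs_def] V_def[abs_def] S_def by (auto intro!: measurable_restrict)
  have [measurable]: "B \<in> borel_measurable S"
    unfolding B_def[abs_def] S_def by measurable
  interpret R: prob_space R unfolding R_def by (rule E.prob_space_distr) simp
  have [measurable_cong]: "sets R = sets S" by (simp add: R_def)
  define V0 where "V0 e = restrict (\<lambda>i. (A *v e) $ i) {j0}" for e :: "real^'d"
  have [measurable]: "V0 \<in> measurable borel (PiM {j0} (\<lambda>_. borel))"
    unfolding V0_def[abs_def] by (auto intro!: measurable_restrict)
  let ?S0 = "PiM {j0} (\<lambda>_::'d. borel :: real measure)"
  interpret N: prob_space "distr \<mu>_eps ?S0 V0" by (rule E.prob_space_distr) simp
  interpret NR: pair_prob_space "distr \<mu>_eps ?S0 V0" R ..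
  interpret LR: pair_sigma_finite lborel R ..
  have "E.indep_var ?S0 V0 S V"
    unfolding V0_def[abs_def] V_def[abs_def] S_def by (rule E.indep_var_restrict[OF ind]) auto
  then have joint: "distr \<mu>_eps (?S0 \<Otimes>\<^sub>M S) (\<lambda>e. (V0 e, V e)) = distr \<mu>_eps ?S0 V0 \<Otimes>\<^sub>M R"
    by (simp add: E.indep_var_distribution_eq R_def)
  have N: "distr \<mu>_eps borel X = density lborel (\<lambda>t. ennreal (g t))"
    using distr_borel_eq_density[OF dist] by (simp add: X_def[abs_def])
  define k where "k = (\<lambda>z. f z * sin (b * z))"
  have k: "integrable lborel k" unfolding k_def by (rule integrable_f_sin)
  have [measurable]: "k \<in> borel_measurable borel" unfolding k_def by measurable
  \<comment> \<open>\<open>G z r\<close> is the mean of the test function at \<open>axis_point A j0 z + e\<close> given that the other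
    coordinates of \<open>A *v e\<close> are \<open>r\<close>.\<close>
  define G where "G z r = (\<integral>x. u (axis_point A j0 (z + x) + B r) * g x \<partial>lborel)" for z r
  have [measurable]: "case_prod G \<in> borel_measurable (lborel \<Otimes>\<^sub>M S)"
    unfolding G_def by measurable
  have G01: "0 \<le> G z r" "G z r \<le> 1" for z r
  proof -
    show "0 \<le> G z r" unfolding G_def using u g0 by simp
    have "G z r \<le> (\<integral>x. g x \<partial>lborel)"
      unfolding G_def using u g0
      by (intro integral_mono' g(1)) (auto intro!: mult_left_le_one_le)
    then show "G z r \<le> 1" using g(2) by simp
  qed
  define U where "U x = (\<integral>e. u (x + e) \<partial>\<mu>_eps)" for x
  have [measurable]: "U \<in> borel_measurable borel" unfolding U_def by measurable
  have U01: "\<bar>U x\<bar> \<le> 1" for x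
  proof -
    have "integrable \<mu>_eps (\<lambda>e. u (x + e))"
      using u by (intro E.integrable_const_bound[where B = 1]) auto
    then have "0 \<le> U x" "U x \<le> 1"
      unfolding U_def using u by (auto intro!: E.integral_le_const)
    then show ?thesis by simp
  qed
  have U_eq: "U (axis_point A j0 z) = (\<integral>r. G z r \<partial>R)" for z
  proof -
    have split: "axis_point A j0 z + e = axis_point A j0 (z + X e) + B (V e)" for e
    proof -
      have "e = (\<Sum>i\<in>UNIV. axis_point A i ((A *v e) $ i))" by (rule sum_axis_point[OF A])
      also have "\<dots> = axis_point A j0 (X e) + B (V e)"
        by (subst sum.remove[of _ j0]) (auto simp: X_def B_def V_def)
      finally show ?thesis by (metis (no_types) add.assoc scaleR_left_distrib axis_point_def)
    qed
    have int: "integrable (distr \<mu>_eps ?S0 V0 \<Otimes>\<^sub>M R) (\<lambda>(w, r). u (axis_point A j0 (z + w j0) + B r))"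
      using u by (intro NR.P.integrable_const_bound[where B = 1]) auto
    have "U (axis_point A j0 z) = (\<integral>e. (\<lambda>(w, r). u (axis_point A j0 (z + w j0) + B r)) (V0 e, V e) \<partial>\<mu>_eps)"
      by (simp add: U_def split V0_def X_def)
    also have "\<dots> = (\<integral>v. (\<lambda>(w, r). u (axis_point A j0 (z + w j0) + B r)) v \<partial>distr \<mu>_eps (?S0 \<Otimes>\<^sub>M S) (\<lambda>e. (V0 e, V e)))"
      by (rule integral_distr[symmetric]) measurable
    also have "\<dots> = (\<integral>r. (\<integral>w. u (axis_point A j0 (z + w j0) + B r) \<partial>distr \<mu>_eps ?S0 V0) \<partial>R)"
      unfolding joint using NR.integral_snd[OF int] by simp
    also have "\<dots> = (\<integral>r. G z r \<partial>R)"
    proof (rule Bochner_Integration.integral_cong[OF refl])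
      fix r assume "r \<in> space R"
      have "(\<integral>x. u (axis_point A j0 (z + x) + B r) \<partial>density lborel (\<lambda>t. ennreal (g t)))
          = (\<integral>x. g x * u (axis_point A j0 (z + x) + B r) \<partial>lborel)"
        using g0 by (subst integral_density) auto
      also have "\<dots> = G z r" by (simp add: G_def mult.commute)
      finally show "(\<integral>w. u (axis_point A j0 (z + w j0) + B r) \<partial>distr \<mu>_eps ?S0 V0) = G z r"
        unfolding N[symmetric] by (simp add: integral_distr V0_def X_def)
    qed
    finally show ?thesis .
  qed
  have law: "(\<integral>y. u y \<partial>(perturbed A j0 f b \<sigma> \<star> \<mu>_eps))
      = (\<integral>z. f z * (1 + \<sigma> * sin (b * z)) * U (axis_point A j0 z) \<partial>lborel)" if \<sigma>: "\<bar>\<sigma>\<bar> \<le> 1" for \<sigma>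
  proof -
    interpret P: prob_space "perturbed A j0 f b \<sigma>" by (rule prob_space_perturbed[OF \<sigma>])
    note sets_perturbed[measurable_cong]
    interpret PE: pair_prob_space "perturbed A j0 f b \<sigma>" \<mu>_eps ..
    have int: "integrable (perturbed A j0 f b \<sigma> \<Otimes>\<^sub>M \<mu>_eps) (\<lambda>(x, e). u (x + e))"
      using u by (intro PE.P.integrable_const_bound[where B = 1]) auto
    have "(\<integral>y. u y \<partial>(perturbed A j0 f b \<sigma> \<star> \<mu>_eps))
        = (\<integral>(x, e). u (x + e) \<partial>(perturbed A j0 f b \<sigma> \<Otimes>\<^sub>M \<mu>_eps))"
      unfolding convolution_def by (subst integral_distr) (auto simp: case_prod_unfold)
    also have "\<dots> = (\<integral>x. U x \<partial>perturbed A j0 f b \<sigma>)"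
      using PE.integral_fst[OF int] by (simp add: U_def)
    also have "\<dots> = (\<integral>z. f z * (1 + \<sigma> * sin (b * z)) * U (axis_point A j0 z) \<partial>lborel)"
      by (rule integral_perturbed[OF \<sigma>]) measurable
    finally show ?thesis .
  qed
  have intU: "integrable lborel (\<lambda>z. f z * (1 + \<sigma> * sin (b * z)) * U (axis_point A j0 z))" for \<sigma>
  proof (rule Bochner_Integration.integrable_bound[OF integrable_density[of \<sigma>]])
    show "AE x in lborel. norm (f x * (1 + \<sigma> * sin (b * x)) * U (axis_point A j0 x)) \<le> norm (f x * (1 + \<sigma> * sin (b * x)))"
      using U01 by (intro AE_I2) (simp only: real_norm_def abs_mult mult_left_le abs_ge_zero mult_nonneg_nonneg)
  qed measurable
  have "(\<integral>y. u y \<partial>(perturbed A j0 f b 1 \<star> \<mu>_eps)) - (\<integral>y. u y \<partial>(perturbed A j0 f b (-1) \<star> \<mu>_eps))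
      = (\<integral>z. f z * (1 + 1 * sin (b * z)) * U (axis_point A j0 z) - f z * (1 + (-1) * sin (b * z)) * U (axis_point A j0 z) \<partial>lborel)"
    using law[of 1] law[of "-1"] Bochner_Integration.integral_diff[OF intU[of 1] intU[of "-1"]] by simp
  also have "\<dots> = (\<integral>z. 2 * (\<integral>r. k z * G z r \<partial>R) \<partial>lborel)"
    by (intro Bochner_Integration.integral_cong refl) (simp add: U_eq k_def algebra_simps)
  also have "\<dots> = 2 * (\<integral>z. (\<integral>r. k z * G z r \<partial>R) \<partial>lborel)"
    by (rule integral_mult_right_zero)
  also have "(\<integral>z. (\<integral>r. k z * G z r \<partial>R) \<partial>lborel) = (\<integral>r. (\<integral>z. k z * G z r \<partial>lborel) \<partial>R)"
  proof (rule LR.Fubini_integral[symmetric])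
    show "integrable (lborel \<Otimes>\<^sub>M R) (\<lambda>(z, r). k z * G z r)"
    proof (rule LR.Fubini_integrable)
      have kG: "norm (k z * G z r) \<le> norm (k z)" for z r
        using G01[of z r] by (simp add: abs_mult mult_left_le)
      have ir: "integrable R (\<lambda>r. k z * G z r)" for z
        using kG[of z] by (intro R.integrable_const_bound[where B = "norm (k z)"]) auto
      then show "AE z in lborel. integrable R (\<lambda>r. case (z, r) of (z, r) \<Rightarrow> k z * G z r)"
        by simp
      show "integrable lborel (\<lambda>z. \<integral>r. norm (case (z, r) of (z, r) \<Rightarrow> k z * G z r) \<partial>R)"
      proof (rule Bochner_Integration.integrable_bound[OF k])
        have "(\<integral>r. norm (k z * G z r) \<partial>R) \<le> norm (k z)" for z
          using ir[of z] kG[of z] by (intro R.integral_le_const) auto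
        then show "AE z in lborel. norm (\<integral>r. norm (case (z, r) of (z, r) \<Rightarrow> k z * G z r) \<partial>R) \<le> norm (k z)"
          by (intro AE_I2) (simp add: abs_of_nonneg)
      qed measurable
    qed measurable
  qed
  finally have eq: "(\<integral>y. u y \<partial>(perturbed A j0 f b 1 \<star> \<mu>_eps)) - (\<integral>y. u y \<partial>(perturbed A j0 f b (-1) \<star> \<mu>_eps))
      = 2 * (\<integral>r. (\<integral>z. k z * G z r \<partial>lborel) \<partial>R)" .
  have each: "\<bar>\<integral>z. k z * G z r \<partial>lborel\<bar> \<le> \<eta>" for r
    unfolding G_def using u \<eta>
    by (intro convolution_test_le k g(1)) (auto simp: k_def)
  have "\<bar>\<integral>r. (\<integral>z. k z * G z r \<partial>lborel) \<partial>R\<bar> \<le> \<eta>"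
  proof -
    have "integrable R (\<lambda>r. \<integral>z. k z * G z r \<partial>lborel)"
      using each by (intro R.integrable_const_bound[where B = \<eta>]) auto
    then show ?thesis
      using each by (intro order_trans[OF integral_abs_bound] R.integral_le_const) auto
  qed
  then show ?thesis unfolding eq by (simp add: abs_mult)
qed

end

section \<open>The minimax lower bound\<close>

lemma prob_space_convolution:
  fixes M N :: "'a::ordered_euclidean_space measure"
  assumes "prob_space M" "prob_space N" and [measurable_cong]: "sets M = sets borel" "sets N = sets borel"
  shows "prob_space (M \<star> N)"
proof -
  interpret M: prob_space M by fact
  interpret N: prob_space N by fact
  interpret MN: pair_prob_space M N ..
  show ?thesis unfolding convolution_def by (rule MN.P.prob_space_distr) measurable
qed

lemma wasserstein_risk_ge_test:
  fixes est :: "(nat \<Rightarrow> real^'d) \<Rightarrow> (real^'d) measure" and \<phi> :: "real^'d \<Rightarrow> real"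
  assumes "p \<ge> 1" "\<phi> \<in> borel_measurable borel" "\<And>x. \<bar>\<phi> x\<bar> \<le> B" "\<And>x y. \<bar>\<phi> x - \<phi> y\<bar> \<le> norm (x - y)"
  shows "(\<integral>\<^sup>+y. ennreal (\<bar>(\<integral>x. \<phi> x \<partial>est y) - (\<integral>x. \<phi> x \<partial>\<mu>)\<bar> powr p) \<partial>PiM {..<n} (\<lambda>_. \<mu> \<star> \<mu>_eps))
    \<le> wasserstein_risk p \<mu>_eps n est \<mu>"
  unfolding wasserstein_risk_def by (intro nn_integral_mono wasserstein_ge_lipschitz[where B = B] assms)

text \<open>
The maximum of the two risks is at least half of their sum.  The integral of \<phi> against the
estimator plays the role of the statistic T, and it is measurable because the estimator is measurable
for the \<sigma>-algebra of evaluations.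
\<close>

lemma two_point_minimax:
  fixes est :: "(nat \<Rightarrow> real^'d) \<Rightarrow> (real^'d) measure" and \<phi> :: "real^'d \<Rightarrow> real"
  assumes p: "p \<ge> 1" and \<phi>[measurable]: "\<phi> \<in> borel_measurable borel" and bd: "\<And>x. \<bar>\<phi> x\<bar> \<le> B"
    and lip: "\<And>x y. \<bar>\<phi> x - \<phi> y\<bar> \<le> norm (x - y)"
    and est: "est \<in> measurable (PiM {..<n} (\<lambda>_. borel)) (prob_algebra borel)"
    and eps: "prob_space \<mu>_eps" "sets \<mu>_eps = sets borel"
    and \<mu>0: "\<mu>0 \<in> \<M>" "prob_space \<mu>0" "sets \<mu>0 = sets borel"
    and \<mu>1: "\<mu>1 \<in> \<M>" "prob_space \<mu>1" "sets \<mu>1 = sets borel"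
    and test: "\<And>u. u \<in> borel_measurable borel \<Longrightarrow> (\<And>x. 0 \<le> u x \<and> u x \<le> 1) \<Longrightarrow>
      \<bar>(\<integral>y. u y \<partial>(\<mu>0 \<star> \<mu>_eps)) - (\<integral>y. u y \<partial>(\<mu>1 \<star> \<mu>_eps))\<bar> \<le> \<tau>"
    and \<tau>: "real n * \<tau> \<le> 1 / 2"
    and sep: "(\<integral>x. \<phi> x \<partial>\<mu>0) - (\<integral>x. \<phi> x \<partial>\<mu>1) \<ge> 2 * D" and D: "D \<ge> 0"
  shows "ennreal (D powr p / 4) \<le> (SUP \<mu>\<in>\<M>. wasserstein_risk p \<mu>_eps n est \<mu>)" (is "_ \<le> ?S")
proof -
  define P where "P = PiM {..<n} (\<lambda>_. \<mu>0 \<star> \<mu>_eps)"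
  define Q where "Q = PiM {..<n} (\<lambda>_. \<mu>1 \<star> \<mu>_eps)"
  have c0: "prob_space (\<mu>0 \<star> \<mu>_eps)" by (intro prob_space_convolution eps \<mu>0)
  have c1: "prob_space (\<mu>1 \<star> \<mu>_eps)" by (intro prob_space_convolution eps \<mu>1)
  have P: "prob_space P" unfolding P_def by (intro prob_space_PiM c0)
  have Q: "prob_space Q" unfolding Q_def by (intro prob_space_PiM c1)
  have setsP[measurable_cong]: "sets P = sets (PiM {..<n} (\<lambda>_. borel))"
    unfolding P_def by (intro sets_PiM_cong) auto
  have setsQ: "sets Q = sets (PiM {..<n} (\<lambda>_. borel))"
    unfolding Q_def by (intro sets_PiM_cong) auto
  define T where "T y = (\<integral>x. \<phi> x \<partial>est y)" for y
  have "(\<lambda>\<mu>. \<integral>x. \<phi> x \<partial>\<mu>) \<in> borel_measurable (subprob_algebra borel)"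
    by (intro integral_measurable_subprob_algebra \<phi>)
  then have T: "T \<in> borel_measurable P"
    unfolding T_def[abs_def] measurable_cong_sets[OF setsP refl]
    by (rule measurable_compose[OF measurable_prob_algebraD[OF est]])
  have tv: "\<bar>measure P E - measure Q E\<bar> \<le> 1 / 2" if E: "E \<in> sets P" for E
  proof -
    have "E \<in> sets Q" using E by (simp add: setsP setsQ)
    then have "\<bar>measure P E - measure Q E\<bar> = \<bar>(\<integral>y. indicator E y \<partial>P) - (\<integral>y. indicator E y \<partial>Q)\<bar>"
      using E sets.sets_into_space[OF E] sets.sets_into_space[of E Q] by (simp add: Int_absorb2)
    also have "\<dots> \<le> real n * \<tau>"
      unfolding P_def Q_def
      by (rule PiM_test_diff_le[OF c0 c1]) (use E in \<open>auto intro!: test simp: P_def\<close>)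
    also note \<tau>
    finally show ?thesis .
  qed
  have "ennreal (D powr p / 2) \<le>
      (\<integral>\<^sup>+y. ennreal (\<bar>T y - (\<integral>x. \<phi> x \<partial>\<mu>0)\<bar> powr p) \<partial>P) + (\<integral>\<^sup>+y. ennreal (\<bar>T y - (\<integral>x. \<phi> x \<partial>\<mu>1)\<bar> powr p) \<partial>Q)"
    using p D sep by (intro two_point_risk P Q T tv) (auto simp: setsP setsQ)
  also have "\<dots> \<le> ?S + ?S"
    unfolding P_def Q_def T_def
    by (intro add_mono order_trans[OF wasserstein_risk_ge_test[OF p \<phi> bd lip]] SUP_upper \<mu>0 \<mu>1)
  finally have le: "ennreal (D powr p / 2) \<le> ?S + ?S" .
  show ?thesis
  proof (cases ?S)
    case (real r)
    then have "?S + ?S = ennreal (r + r)" by (simp only: ennreal_plus)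
    with le have "ennreal (D powr p / 2) \<le> ennreal (r + r)" by (simp only:)
    then have "D powr p / 2 \<le> r + r" by (rule iffD1[OF ennreal_le_iff, rotated]) (use real in simp)
    then show ?thesis using real by (simp add: ennreal_leI)
  next
    case top
    then show ?thesis by (simp only: top_greatest)
  qed
qed

text \<open>
Half of the exponential rate absorbs the polynomial factor and the constant.
\<close>

lemma supersmooth_decay:
  fixes \<beta> \<beta>' \<gamma>1 c1 :: real and F :: "real \<Rightarrow> complex"
  assumes "\<beta> > 0" "\<gamma>1 > 0"
    and F: "\<And>w. cmod (F w) * (1 + \<bar>w\<bar>) powr (- \<beta>') * exp (\<bar>w\<bar> powr \<beta> / \<gamma>1) \<le> c1"
  obtains w0 where "w0 > 0" "\<And>s w. w0 \<le> s \<Longrightarrow> s \<le> \<bar>w\<bar> \<Longrightarrow> cmod (F w) \<le> exp (- (s powr \<beta> / (2 * \<gamma>1)))"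
proof -
  have "((\<lambda>x. c1 * (1 + x) powr \<beta>' * exp (- (x powr \<beta> / (2 * \<gamma>1)))) \<longlongrightarrow> 0) at_top"
    using assms(1,2) by real_asymp
  then have "eventually (\<lambda>x. c1 * (1 + x) powr \<beta>' * exp (- (x powr \<beta> / (2 * \<gamma>1))) < 1) at_top"
    by (rule order_tendstoD) simp
  then obtain w1 where w1: "\<And>x. w1 \<le> x \<Longrightarrow> c1 * (1 + x) powr \<beta>' * exp (- (x powr \<beta> / (2 * \<gamma>1))) < 1"
    unfolding eventually_at_top_linorder by auto
  show ?thesis
  proof (rule that[of "max 1 w1"])
    fix s w :: real
    assume s: "max 1 w1 \<le> s" "s \<le> \<bar>w\<bar>"
    define x where "x = \<bar>w\<bar>"
    have x: "1 + x > 0" "w1 \<le> x" using s by (auto simp: x_def)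
    have "cmod (F w) = cmod (F w) * (1 + x) powr (- \<beta>') * exp (x powr \<beta> / \<gamma>1) *
        ((1 + x) powr \<beta>' * exp (- (x powr \<beta> / \<gamma>1)))"
      using x by (simp add: powr_minus exp_minus field_simps)
    also have "\<dots> \<le> c1 * ((1 + x) powr \<beta>' * exp (- (x powr \<beta> / \<gamma>1)))"
      using F[of w] by (intro mult_right_mono) (auto simp: x_def)
    also have "\<dots> = (c1 * (1 + x) powr \<beta>' * exp (- (x powr \<beta> / (2 * \<gamma>1)))) * exp (- (x powr \<beta> / (2 * \<gamma>1)))"
      by (simp add: mult.assoc exp_add[symmetric])
    also have "\<dots> \<le> 1 * exp (- (x powr \<beta> / (2 * \<gamma>1)))"
      using w1[OF x(2)] by (intro mult_right_mono) auto
    also have "\<dots> \<le> exp (- (s powr \<beta> / (2 * \<gamma>1)))"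
    proof -
      have "s powr \<beta> \<le> x powr \<beta>" using s assms(1) by (intro powr_mono2) (auto simp: x_def)
      then show ?thesis using assms(2) by (simp add: divide_right_mono)
    qed
    finally show "cmod (F w) \<le> exp (- (s powr \<beta> / (2 * \<gamma>1)))" .
  qed simp
qed

lemma sin_coordinate_lipschitz:
  fixes A :: "real^'d^'d"
  obtains K where "K > 0" "\<And>b x y. b > 0 \<Longrightarrow>
    \<bar>sin (b * (A *v x) $ j) / (b * K) - sin (b * (A *v y) $ j) / (b * K)\<bar> \<le> norm (x - y)"
proof -
  obtain K where K: "K > 0" "\<And>x. norm (A *v x) \<le> norm x * K"
    using bounded_linear.pos_bounded[OF matrix_vector_mul_bounded_linear[of A]] by blast
  have "\<bar>sin (b * (A *v x) $ j) / (b * K) - sin (b * (A *v y) $ j) / (b * K)\<bar> \<le> norm (x - y)"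
    if b: "b > 0" for b x y
  proof -
    have lip: "\<bar>sin u - sin v\<bar> \<le> \<bar>u - v\<bar>" for u v :: real
    proof -
      have "\<bar>sin u - sin v\<bar> = 2 * \<bar>sin ((u - v) / 2)\<bar> * \<bar>cos ((u + v) / 2)\<bar>"
        by (simp add: sin_diff_sin abs_mult)
      also have "\<dots> \<le> 2 * \<bar>(u - v) / 2\<bar> * 1"
        by (intro mult_mono abs_sin_x_le_abs_x) auto
      finally show ?thesis by simp
    qed
    have "\<bar>sin (b * (A *v x) $ j) - sin (b * (A *v y) $ j)\<bar> \<le> \<bar>b * (A *v x) $ j - b * (A *v y) $ j\<bar>"
      by (rule lip)
    also have "\<dots> = b * \<bar>(A *v (x - y)) $ j\<bar>"
      using b by (simp add: matrix_vector_mult_diff_distrib abs_mult right_diff_distrib[symmetric])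
    also have "\<dots> \<le> b * (norm (x - y) * K)"
      using b by (intro mult_left_mono order_trans[OF component_le_norm_cart K(2)]) auto
    finally have "\<bar>sin (b * (A *v x) $ j) - sin (b * (A *v y) $ j)\<bar> / (b * K) \<le> norm (x - y)"
      using b K(1) by (simp add: pos_divide_le_eq mult_ac)
    then show ?thesis
      using b K(1) by (simp add: diff_divide_distrib[symmetric] abs_divide abs_mult)
  qed
  with K(1) show ?thesis using that by blast
qed

theorem theorem2:
  fixes \<mu>_eps :: "(real^'d) measure"
    and A :: "real^'d^'d"
    and j0 :: 'd
    and g :: "real \<Rightarrow> real"
    and M p a \<beta> \<beta>' \<gamma>1 c1 \<kappa>1 \<kappa>2 :: real
  assumes "M > 1" and "p \<ge> 1" and "a > 1"
    and "prob_space \<mu>_eps" and "sets \<mu>_eps = sets borel"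
    and "invertible A"
    and "prob_space.indep_vars \<mu>_eps (\<lambda>_. borel) (\<lambda>j x. (A *v x) $ j) UNIV"
    and "\<And>t. g t \<ge> 0"
    and "distributed \<mu>_eps lborel (\<lambda>x. (A *v x) $ j0) (\<lambda>t. ennreal (g t))"
    and "\<beta> > 0" and "\<gamma>1 > 0" and "c1 > 0"
    and "\<And>w. cmod (fourier g w) * (1 + \<bar>w\<bar>) powr (- \<beta>') * exp (\<bar>w\<bar> powr \<beta> / \<gamma>1) \<le> c1"
    and "0 < \<kappa>1" and "\<kappa>1 < 1" and "\<kappa>2 > 1"
    and "(\<lambda>t. measure \<mu>_eps {x \<in> space \<mu>_eps. \<bar>(A *v x) $ j0 - t\<bar> \<le> \<bar>t\<bar> powr \<kappa>1})
           \<in> O[at_infinity](\<lambda>t. \<bar>t\<bar> powr (- \<kappa>2))"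
    and "max (p + 1 + a / 2) (\<kappa>2 / (2 * \<kappa>1) + 1 / 2) < \<kappa>2"
  shows "\<exists>C::real. C > 0 \<and>
    (\<forall>\<mu>_est. estimator \<mu>_est \<longrightarrow>
       liminf (\<lambda>n. ennreal (ln (real n) powr (p / \<beta>)) *
         (SUP \<mu>\<in>moment_class A M p a. wasserstein_risk p \<mu>_eps n (\<mu>_est n) \<mu>))
       \<ge> ennreal C)"

proof -
  note M = assms(1) and p = assms(2) and a = assms(3) and eps = assms(4) and sets_eps[measurable_cong] = assms(5)
    and A = assms(6) and ind = assms(7) and g0 = assms(8) and dist = assms(9)
    and \<beta> = assms(10) and \<gamma>1 = assms(11) and F = assms(13) and ball = assms(17)
  \<comment> \<open>From \<open>p + 1 + a / 2 < \<kappa>2\<close> with \<open>p \<ge> 1\<close> and \<open>a > 1\<close>.\<close>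
  have \<kappa>2: "\<kappa>2 > 5 / 2" using p a assms(18) by simp
  interpret E: prob_space \<mu>_eps by (rule eps)
  have space_eps: "space \<mu>_eps = UNIV"
    using sets_eq_imp_space_eq[OF sets_eps] by simp
  define X where "X e = (A *v e) $ j0" for e :: "real^'d"
  have [measurable]: "X \<in> borel_measurable borel" unfolding X_def[abs_def] by measurable
  have N: "distr \<mu>_eps borel X = density lborel (\<lambda>t. ennreal (g t))"
    using distr_borel_eq_density[OF dist] by (simp add: X_def[abs_def])
  have gm[measurable]: "g \<in> borel_measurable borel"
    using distributed_real_measurable[OF _ dist] g0 by simp
  interpret N: prob_space "density lborel (\<lambda>t. ennreal (g t))"
    unfolding N[symmetric] by (rule E.prob_space_distr) simp
  have g1: "(\<integral>\<^sup>+t. ennreal (g t) \<partial>lborel) = 1"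
    using N.emeasure_space_1 by (simp add: emeasure_density)
  have g_int: "integrable lborel g"
    using g1 g0 by (intro integrableI_nonneg) auto
  have g_one: "(\<integral>t. g t \<partial>lborel) = 1"
    using g1 g0 nn_integral_eq_integral[OF g_int] by simp
  have wg: "(\<integral>\<^sup>+x. ennreal (weight x * g x) \<partial>lborel) < \<top>"
  proof -
    have "measure \<mu>_eps {x \<in> space \<mu>_eps. \<bar>(A *v x) $ j0 - t\<bar> \<le> \<bar>t\<bar> powr \<kappa>1}
        = measure (density lborel (\<lambda>t. ennreal (g t))) {x. \<bar>x - t\<bar> \<le> \<bar>t\<bar> powr \<kappa>1}" for t
      unfolding N[symmetric] by (subst measure_distr) (auto intro!: arg_cong[where f = "measure \<mu>_eps"] simp: X_def space_eps)
    then have "(\<integral>\<^sup>+x. ennreal (weight x) \<partial>density lborel (\<lambda>t. ennreal (g t))) < \<top>"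
      using ball \<kappa>2 assms(14) by (intro nn_integral_weight_finite[of _ \<kappa>1 \<kappa>2] N.prob_space_axioms) auto
    then show ?thesis
      using g0 weight_nonneg by (simp add: nn_integral_density ennreal_mult mult.commute)
  qed

  obtain f \<Lambda> Cf where fm[measurable]: "f \<in> borel_measurable borel"
    and f0: "\<And>x. 0 \<le> f x" and f_even: "\<And>x. f (- x) = f x" and f_cont: "isCont f 0" "f 0 > 0"
    and f_int: "integrable lborel f" and f_one: "(\<integral>x. f x \<partial>lborel) = 1"
    and f_mi: "integrable lborel (\<lambda>x. (\<bar>x\<bar> + \<bar>x\<bar> powr (2 * p + a)) * f x)"
    and f_mom: "(\<integral>x. (\<bar>x\<bar> + \<bar>x\<bar> powr (2 * p + a)) * f x \<partial>lborel) \<le> (M - 1) / 2"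
    and bl: "band_limited f \<Lambda> Cf" and Cf: "Cf \<ge> 0"
    using ex_band_limited_density[of "2 * p + a" "(M - 1) / 2"] M p a by auto
  have wf: "(\<integral>\<^sup>+x. ennreal (weight x * f x) \<partial>lborel) < \<top>"
  proof -
    have "(\<integral>\<^sup>+x. ennreal (weight x * f x) \<partial>lborel)
        \<le> (\<integral>\<^sup>+x. ennreal (f x + (\<bar>x\<bar> + \<bar>x\<bar> powr (2 * p + a)) * f x) \<partial>lborel)"
    proof (intro nn_integral_mono ennreal_leI)
      fix x :: real
      have "sqrt (1 + \<bar>x\<bar>) \<le> sqrt ((1 + \<bar>x\<bar>)\<^sup>2)"
        by (intro real_sqrt_le_mono self_le_power) auto
      then have "weight x \<le> 1 + (\<bar>x\<bar> + \<bar>x\<bar> powr (2 * p + a))"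
        unfolding weight_def by (rule order_trans) simp
      then have "weight x * f x \<le> (1 + (\<bar>x\<bar> + \<bar>x\<bar> powr (2 * p + a))) * f x"
        using f0 by (intro mult_right_mono) auto
      then show "weight x * f x \<le> f x + (\<bar>x\<bar> + \<bar>x\<bar> powr (2 * p + a)) * f x"
        by (simp add: distrib_right)
    qed
    also have "\<dots> < \<top>"
      using f0 by (subst nn_integral_eq_integral[OF Bochner_Integration.integrable_add[OF f_int f_mi]]) auto
    finally show ?thesis .
  qed
  define m where "m = 1 + enn2real ((\<integral>\<^sup>+x. ennreal (weight x * f x) \<partial>lborel) + (\<integral>\<^sup>+x. ennreal (weight x * g x) \<partial>lborel))"
  have m: "m \<ge> 1" by (simp add: m_def)
  have m_le: "(\<integral>\<^sup>+x. ennreal (weight x * f x) \<partial>lborel) + (\<integral>\<^sup>+x. ennreal (weight x * g x) \<partial>lborel) \<le> ennreal m"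
    using wf wg by (simp add: m_def ennreal_plus ennreal_enn2real add_increasing)

  obtain c b0 where c: "c > 0" and c_le: "\<And>b. b \<ge> b0 \<Longrightarrow> c \<le> (\<integral>x. f x * (sin (b * x))\<^sup>2 \<partial>lborel)"
    using integral_sin_square_lower_bound[OF f_int f0 f_cont] by blast
  obtain w0 where w0: "w0 > 0" and decay: "\<And>s w. w0 \<le> s \<Longrightarrow> s \<le> \<bar>w\<bar> \<Longrightarrow>
      cmod (fourier g w) \<le> exp (- (s powr \<beta> / (2 * \<gamma>1)))"
    using supersmooth_decay[OF \<beta> \<gamma>1 F] by blast
  obtain K where K: "K > 0" and lip: "\<And>b x y. b > 0 \<Longrightarrow>
    \<bar>sin (b * (A *v x) $ j0) / (b * K) - sin (b * (A *v y) $ j0) / (b * K)\<bar> \<le> norm (x - y)"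
    using sin_coordinate_lipschitz[of A j0] by blast

  \<comment> \<open>The constant is chosen such that \<open>(b n / 2) powr \<beta> = 8 * \<gamma>1 * ln n\<close>, which makes the Fourier
    transform of \<open>g\<close> at most \<open>n ^ (-4)\<close> beyond frequency \<open>b n / 2\<close>.\<close>
  define B where "B = 2 * (8 * \<gamma>1) powr (1 / \<beta>)"
  have B: "B > 0" using \<gamma>1 by (simp add: B_def)
  define b where "b n = B * ln (real n) powr (1 / \<beta>)" for n :: nat
  define C where "C = (c / (B * K)) powr p / 4"
  have C: "C > 0" using c B K by (simp add: C_def)

  have "filterlim b at_top sequentially"
    unfolding b_def[abs_def] using B \<beta> by real_asymp
  then have large: "eventually (\<lambda>n. b n \<ge> Z) sequentially" for Z
    by (simp add: filterlim_at_top)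
  have n_large: "eventually (\<lambda>n. real n \<ge> Z) sequentially" for Z
    using filterlim_real_sequentially by (simp add: filterlim_at_top)

  have main: "eventually (\<lambda>n. ennreal C \<le> ennreal (ln (real n) powr (p / \<beta>)) *
      (SUP \<mu>\<in>moment_class A M p a. wasserstein_risk p \<mu>_eps n (\<mu>_est n) \<mu>)) sequentially"
    if est: "estimator \<mu>_est" for \<mu>_est
    using n_large[of 3] n_large[of "1024 * m\<^sup>2 * Cf"] large[of b0] large[of "2 * w0"] large[of "2 * \<Lambda>"] large[of 1]
  proof eventually_elim
    case (elim n)
    have n: "real n > 0" "real n \<ge> 3" using elim by auto
    have bn: "b n > 0" using elim by simp
    have ln: "ln (real n) > 0" using n by (intro ln_gt_zero) auto
    interpret perturbation f "b n"
      by standard (fact f_int f0 f_even f_one)+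
    have half: "(b n / 2) powr \<beta> / (2 * \<gamma>1) = 4 * ln (real n)"
    proof -
      have "b n / 2 = (8 * \<gamma>1 * ln (real n)) powr (1 / \<beta>)"
        using \<gamma>1 ln by (simp add: b_def B_def powr_mult)
      then have "(b n / 2) powr \<beta> = 8 * \<gamma>1 * ln (real n)"
        using \<gamma>1 ln \<beta> by (simp add: powr_powr)
      then show ?thesis using \<gamma>1 by simp
    qed
    define \<rho> where "\<rho> = 1 / real n ^ 4"
    have \<rho>: "cmod (fourier g w) \<le> \<rho>" if "\<bar>w\<bar> \<ge> b n / 2" for w
    proof -
      have "cmod (fourier g w) \<le> exp (- (4 * ln (real n)))"
        using decay[of "b n / 2" w] that elim unfolding half by simp
      also have "\<dots> = \<rho>"
        using n by (simp add: \<rho>_def exp_minus inverse_eq_divide exp_of_nat_mult[of 4, simplified])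
      finally show ?thesis .
    qed
    \<comment> \<open>The tail term \<open>m / sqrt R\<close> is then \<open>1 / (8 * n)\<close>, half of \<open>\<eta>\<close>; the other term is of order
    \<open>R * n ^ (-4)\<close>, that is, \<open>n ^ (-2)\<close>.\<close>
    define R where "R = (8 * m * real n)\<^sup>2"
    have R: "R > 0" "sqrt R = 8 * m * real n" using m n by (auto simp: R_def)
    define \<eta> where "\<eta> = 1 / (4 * real n)"
    have "(\<integral>\<^sup>+y. ennreal \<bar>\<integral>z. (f z * sin (b n * z)) * g (y - z) \<partial>lborel\<bar> \<partial>lborel)
        \<le> ennreal (2 * R * (Cf * \<rho>)) + ennreal (1 / sqrt R) *
          ((\<integral>\<^sup>+x. ennreal (weight x * f x) \<partial>lborel) + (\<integral>\<^sup>+x. ennreal (weight x * g x) \<partial>lborel))"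
      using elim bn
      by (intro nn_integral_perturbation_le[where \<Lambda> = \<Lambda> and ?s0.0 = "b n / 2"]
          f_int f0 f_one g_int g0 g_one bl Cf \<rho> R) (auto simp: \<rho>_def)
    also have "\<dots> \<le> ennreal (2 * R * (Cf * \<rho>)) + ennreal (1 / sqrt R) * ennreal m"
      by (intro add_left_mono mult_left_mono m_le) simp
    also have "\<dots> = ennreal (2 * R * (Cf * \<rho>) + 1 / sqrt R * m)"
      using R(1) Cf m by (simp add: ennreal_plus ennreal_mult[symmetric] \<rho>_def)
    also have "\<dots> \<le> ennreal \<eta>"
    proof (rule ennreal_leI)
      have "1 / sqrt R * m = 1 / (8 * real n)"
        using m n by (simp add: R(2))
      moreover have "2 * R * (Cf * \<rho>) = 128 * m\<^sup>2 * Cf / real n ^ 2"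
        using n by (simp add: R_def \<rho>_def power_mult_distrib field_simps power2_eq_square power4_eq_xxxx)
      moreover have "128 * m\<^sup>2 * Cf / real n ^ 2 \<le> 1 / (8 * real n)"
        using elim(2) n by (simp add: field_simps power2_eq_square)
      ultimately show "2 * R * (Cf * \<rho>) + 1 / sqrt R * m \<le> \<eta>"
        by (simp add: \<eta>_def field_simps)
    qed
    finally have \<eta>: "(\<integral>\<^sup>+y. ennreal \<bar>\<integral>z. (f z * sin (b n * z)) * g (y - z) \<partial>lborel\<bar> \<partial>lborel) \<le> ennreal \<eta>" .
    have \<eta>0: "\<eta> \<ge> 0" by (simp add: \<eta>_def)

    define \<phi> where "\<phi> x = sin (b n * (A *v x) $ j0) / (b n * K)" for x :: "real^'d"
    have \<phi>m[measurable]: "\<phi> \<in> borel_measurable borel"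
      unfolding \<phi>_def[abs_def] by measurable
    have \<phi>_bd: "\<bar>\<phi> x\<bar> \<le> 1 / (b n * K)" for x
      using bn K by (simp add: \<phi>_def abs_divide abs_mult divide_right_mono)
    define I where "I = (\<integral>z. f z * (sin (b n * z))\<^sup>2 \<partial>lborel)"
    have L: "(\<integral>x. \<phi> x \<partial>perturbed A j0 f (b n) \<sigma>) = \<sigma> * I / (b n * K)" if "\<bar>\<sigma>\<bar> \<le> 1" for \<sigma>
    proof -
      have i2: "integrable lborel (\<lambda>z. f z * (sin (b n * z))\<^sup>2)"
        by (rule integrable_f_mult[where B = 1]) (auto simp: abs_square_le_1)
      have "(\<integral>x. \<phi> x \<partial>perturbed A j0 f (b n) \<sigma>)
          = (\<integral>z. (f z * sin (b n * z) + \<sigma> * (f z * (sin (b n * z))\<^sup>2)) / (b n * K) \<partial>lborel)"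
        unfolding integral_perturbed[OF that \<phi>m]
        by (intro Bochner_Integration.integral_cong refl)
          (simp add: \<phi>_def coordinate_axis_point[OF A] algebra_simps power2_eq_square add_divide_distrib)
      also have "\<dots> = \<sigma> * I / (b n * K)"
        using i2 integrable_f_sin by (simp add: integral_f_sin I_def)
      finally show ?thesis .
    qed
    have "ennreal ((c / (b n * K)) powr p / 4)
        \<le> (SUP \<mu>\<in>moment_class A M p a. wasserstein_risk p \<mu>_eps n (\<mu>_est n) \<mu>)"
    proof (rule two_point_minimax[where \<phi> = \<phi> and B = "1 / (b n * K)" and \<tau> = "2 * \<eta>"
          and ?\<mu>0.0 = "perturbed A j0 f (b n) 1" and ?\<mu>1.0 = "perturbed A j0 f (b n) (-1)"])
      show "\<mu>_est n \<in> measurable (PiM {..<n} (\<lambda>_. borel)) (prob_algebra borel)"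
        using est by (simp add: estimator_def)
      show "\<bar>\<phi> x - \<phi> y\<bar> \<le> norm (x - y)" for x y
        unfolding \<phi>_def by (rule lip[OF bn])
      show "perturbed A j0 f (b n) 1 \<in> moment_class A M p a" "perturbed A j0 f (b n) (-1) \<in> moment_class A M p a"
        using a p by (auto intro!: perturbed_in_moment_class A f_mi f_mom)
      show "\<bar>(\<integral>y. u y \<partial>(perturbed A j0 f (b n) 1 \<star> \<mu>_eps)) - (\<integral>y. u y \<partial>(perturbed A j0 f (b n) (-1) \<star> \<mu>_eps))\<bar> \<le> 2 * \<eta>"
        if "u \<in> borel_measurable borel" "\<And>x. 0 \<le> u x \<and> u x \<le> 1" for u
        by (rule observation_test_diff_le[OF eps sets_eps A ind g0 dist g_int g_one that \<eta> \<eta>0])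
      show "real n * (2 * \<eta>) \<le> 1 / 2" using n by (simp add: \<eta>_def)
      have "c \<le> I" unfolding I_def by (rule c_le) (use elim in simp)
      then have "c / (b n * K) \<le> I / (b n * K)"
        using bn K by (intro divide_right_mono) auto
      moreover have "(\<integral>x. \<phi> x \<partial>perturbed A j0 f (b n) 1) = I / (b n * K)"
        "(\<integral>x. \<phi> x \<partial>perturbed A j0 f (b n) (-1)) = - (I / (b n * K))"
        by (simp_all add: L)
      ultimately show "2 * (c / (b n * K)) \<le> (\<integral>x. \<phi> x \<partial>perturbed A j0 f (b n) 1) - (\<integral>x. \<phi> x \<partial>perturbed A j0 f (b n) (-1))"
        by linarith
    qed (use p \<phi>m \<phi>_bd eps sets_eps c bn K in \<open>auto simp: prob_space_perturbed sets_perturbed\<close>)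
    then have "ennreal (ln (real n) powr (p / \<beta>)) * ennreal ((c / (b n * K)) powr p / 4)
        \<le> ennreal (ln (real n) powr (p / \<beta>)) *
          (SUP \<mu>\<in>moment_class A M p a. wasserstein_risk p \<mu>_eps n (\<mu>_est n) \<mu>)"
      by (rule mult_left_mono) simp
    moreover have "ln (real n) powr (p / \<beta>) * ((c / (b n * K)) powr p / 4) = C"
    proof -
      have "c / (b n * K) = c / (B * K) * ln (real n) powr (- (1 / \<beta>))"
        by (simp add: b_def powr_minus field_simps)
      then have "(c / (b n * K)) powr p = (c / (B * K) * ln (real n) powr (- (1 / \<beta>))) powr p"
        by (simp only:)
      also have "\<dots> = (c / (B * K)) powr p * (ln (real n) powr (- (1 / \<beta>))) powr p"
        by (rule powr_mult)
      also have "(ln (real n) powr (- (1 / \<beta>))) powr p = ln (real n) powr (- (p / \<beta>))"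
        by (simp add: powr_powr)
      finally have "(c / (b n * K)) powr p = (c / (B * K)) powr p * ln (real n) powr (- (p / \<beta>))" .
      then show ?thesis
        using ln by (simp add: C_def powr_minus field_simps)
    qed
    ultimately show ?case by (simp add: ennreal_mult[symmetric])
  qed
  show ?thesis
    using C main by (intro exI[of _ C]) (auto intro!: Liminf_bounded)
qed

end
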